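(* There is an absolute constant $C>0$ such that for every $n\ge 2$ and every Boolean function $f:\{0,1\}^n\times\{0,1\}^n\to\{0,1\}$, $$Q^{\parallel}(f)\le C\cdot 2^{8\,Q^{ent}(f)}\log n .$$
   Context: All protocols compute $f$ with error probability at most $1/3$ on every input. $Q^{\parallel}(f)$ is the minimal total number of qubits communicated in a quantum simultaneous-message-passing (SMP) protocol for $f$ with no shared randomness and no shared entanglement: Alice (holding $x$) and Bob (holding $y$) each send one quantum message to a referee who holds no input and outputs the answer. $Q^{ent}(f)$ is the minimal number of qubits communicated in an arbitrary (multi-round, interactive) two-party quantum protocol between Alice and Bob computing $f$, where Alice and Bob may start with an arbitrary shared entangled state of unlimited size (not counted in the cost). *)

theory Defs
  imports Complex_Main
begin

text \<open>
  A system of N qubits, indexed 0..<N.  Computational basis states are bit strings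
  (bool lists of length N).  A pure state is a complex amplitude function on basis
  strings; an operator is given by its matrix entries U z w.
\<close>

type_synonym qstate = "bool list \<Rightarrow> complex"
type_synonym qop = "bool list \<Rightarrow> bool list \<Rightarrow> complex"

definition bits :: "nat \<Rightarrow> bool list set" where
  "bits N = {z. length z = N}"

definition agree_on :: "nat set \<Rightarrow> bool list \<Rightarrow> bool list \<Rightarrow> bool" where
  "agree_on S z w \<longleftrightarrow> (\<forall>i\<in>S. z ! i = w ! i)"

definition unitary_op :: "nat \<Rightarrow> qop \<Rightarrow> bool" where
  "unitary_op N U \<longleftrightarrow>
     (\<forall>z\<in>bits N. \<forall>w\<in>bits N.
        (\<Sum>u\<in>bits N. cnj (U u z) * U u w) = (if z = w then 1 else 0))"

text \<open>U acts only on the qubits in S, i.e. U = V \<otimes> Id (Id on the qubits outside S).\<close>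
definition acts_on :: "nat \<Rightarrow> nat set \<Rightarrow> qop \<Rightarrow> bool" where
  "acts_on N S U \<longleftrightarrow>
     (\<forall>z\<in>bits N. \<forall>w\<in>bits N. \<not> agree_on ({0..<N} - S) z w \<longrightarrow> U z w = 0) \<and>
     (\<forall>z\<in>bits N. \<forall>w\<in>bits N. \<forall>z'\<in>bits N. \<forall>w'\<in>bits N.
        agree_on S z z' \<and> agree_on S w w' \<and>
        agree_on ({0..<N} - S) z w \<and> agree_on ({0..<N} - S) z' w' \<longrightarrow> U z w = U z' w')"

definition app :: "nat \<Rightarrow> qop \<Rightarrow> qstate \<Rightarrow> qstate" where
  "app N U \<psi> = (\<lambda>z. \<Sum>w\<in>bits N. U z w * \<psi> w)"

definition unit_vec :: "nat \<Rightarrow> qstate \<Rightarrow> bool" where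
  "unit_vec N \<psi> \<longleftrightarrow> (\<Sum>z\<in>bits N. (cmod (\<psi> z))\<^sup>2) = 1"

definition zero_state :: "nat \<Rightarrow> qstate" where
  "zero_state N = (\<lambda>z. if z = replicate N False then 1 else 0)"

definition prob_one :: "nat \<Rightarrow> nat \<Rightarrow> qstate \<Rightarrow> real" where
  "prob_one N q \<psi> = (\<Sum>z\<in>{z\<in>bits N. z ! q}. (cmod (\<psi> z))\<^sup>2)"

definition correct_whp :: "bool \<Rightarrow> real \<Rightarrow> bool" where
  "correct_whp b p \<longleftrightarrow> (if b then p \<ge> 2/3 else p \<le> 1/3)"

text \<open>A round: (sender is Alice?, sender's unitary as function of the sender's input,
  set of qubits sent to the other party after applying the unitary).\<close>
type_synonym round = "bool \<times> (bool list \<Rightarrow> qop) \<times> nat set"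

fun ownA :: "nat set \<Rightarrow> round list \<Rightarrow> nat set" where
  "ownA A [] = A"
| "ownA A ((s, U, M) # rs) = ownA (if s then A - M else A \<union> M) rs"

fun valid_rounds :: "nat \<Rightarrow> nat \<Rightarrow> nat set \<Rightarrow> round list \<Rightarrow> bool" where
  "valid_rounds N n A [] = True"
| "valid_rounds N n A ((s, U, M) # rs) =
     (let S = (if s then A else {0..<N} - A) in
       M \<subseteq> S \<and>
       (\<forall>v. length v = n \<longrightarrow> unitary_op N (U v) \<and> acts_on N S (U v)) \<and>
       valid_rounds N n (if s then A - M else A \<union> M) rs)"

fun run :: "nat \<Rightarrow> bool list \<Rightarrow> bool list \<Rightarrow> round list \<Rightarrow> qstate \<Rightarrow> qstate" where
  "run N x y [] \<psi> = \<psi>"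
| "run N x y ((s, U, M) # rs) \<psi> = run N x y rs (app N (U (if s then x else y)) \<psi>)"

definition cost :: "round list \<Rightarrow> nat" where
  "cost rs = sum_list (map (\<lambda>(s, U, M). card M) rs)"

text \<open>Alice initially owns qubits A, Bob owns {0..<N} - A; the initial state \<psi>0 is an
  arbitrary (shared, possibly entangled) state; at the end Bob measures qubit q.\<close>
definition ent_computes ::
  "nat \<Rightarrow> (bool list \<Rightarrow> bool list \<Rightarrow> bool) \<Rightarrow> nat \<Rightarrow> nat set \<Rightarrow> qstate \<Rightarrow> round list \<Rightarrow> nat \<Rightarrow> bool" where
  "ent_computes n f N A \<psi>0 rs q \<longleftrightarrow>
     A \<subseteq> {0..<N} \<and> unit_vec N \<psi>0 \<and> valid_rounds N n A rs \<and>
     q < N \<and> q \<notin> ownA A rs \<and>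
     (\<forall>x y. length x = n \<longrightarrow> length y = n \<longrightarrow>
        correct_whp (f x y) (prob_one N q (run N x y rs \<psi>0)))"

definition Q_ent :: "nat \<Rightarrow> (bool list \<Rightarrow> bool list \<Rightarrow> bool) \<Rightarrow> nat" where
  "Q_ent n f = (LEAST k. \<exists>N A \<psi>0 rs q. ent_computes n f N A \<psi>0 rs q \<and> cost rs = k)"

text \<open>Alice owns qubits SA, Bob owns SB, the referee owns the rest R; all start in |0>.
  Alice applies UA x on SA and sends MA \<subseteq> SA; Bob applies UB y on SB and sends MB \<subseteq> SB;
  the referee applies V on MA \<union> MB \<union> R and measures qubit q.\<close>
definition smp_computes ::
  "nat \<Rightarrow> (bool list \<Rightarrow> bool list \<Rightarrow> bool) \<Rightarrow> nat \<Rightarrow> nat set \<Rightarrow> nat set \<Rightarrow> nat set \<Rightarrow> nat set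
    \<Rightarrow> (bool list \<Rightarrow> qop) \<Rightarrow> (bool list \<Rightarrow> qop) \<Rightarrow> qop \<Rightarrow> nat \<Rightarrow> bool" where
  "smp_computes n f N SA SB MA MB UA UB V q \<longleftrightarrow>
     (let R = {0..<N} - SA - SB in
       SA \<subseteq> {0..<N} \<and> SB \<subseteq> {0..<N} \<and> SA \<inter> SB = {} \<and> MA \<subseteq> SA \<and> MB \<subseteq> SB \<and>
       (\<forall>x. length x = n \<longrightarrow> unitary_op N (UA x) \<and> acts_on N SA (UA x)) \<and>
       (\<forall>y. length y = n \<longrightarrow> unitary_op N (UB y) \<and> acts_on N SB (UB y)) \<and>
       unitary_op N V \<and> acts_on N (MA \<union> MB \<union> R) V \<and> q \<in> MA \<union> MB \<union> R \<and>
       (\<forall>x y. length x = n \<longrightarrow> length y = n \<longrightarrow>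
          correct_whp (f x y)
            (prob_one N q (app N V (app N (UB y) (app N (UA x) (zero_state N)))))))"

definition Q_smp :: "nat \<Rightarrow> (bool list \<Rightarrow> bool list \<Rightarrow> bool) \<Rightarrow> nat" where
  "Q_smp n f = (LEAST k. \<exists>N SA SB MA MB UA UB V q.
      smp_computes n f N SA SB MA MB UA UB V q \<and> card MA + card MB = k)"

end

theory Submission
  imports Defs "HOL-Library.FuncSet"
begin

text \<open>
  In the Heisenberg picture, a \<open>k\<close>-qubit protocol measures an operator that is a sum of \<open>4\<^sup>k\<close> products
  \<open>X\<^sub>i(x) Y\<^sub>i(y)\<close> of contractions of Alice's and of Bob's initial qubits, because handing over a
  qubit splits every term into four. So its acceptance probability is \<open>4\<^sup>k \<langle>a\<^sub>x, b\<^sub>y\<rangle>\<close>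
  with vectors of norm at most 1, whatever the dimension of the shared state.

  Random sign sums of the coordinates, truncated to be bounded, preserve all \<open>4\<^sup>n\<close> inner products
  up to a small multiple of \<open>4\<^sup>-\<^sup>k\<close> in dimension polynomial in \<open>n\<close> and \<open>4\<^sup>k\<close> (Hoeffding and a union
  bound). These vectors are fingerprints of \<open>O(log n + k)\<close> qubits. A common component \<open>1 / \<surd>2\<close> keeps
  the inner products near \<open>1/2\<close>, so that squaring them only scales the gap by a constant, and
  \<open>O(16\<^sup>k)\<close> swap tests followed by a threshold decide \<open>f\<close>.
\<close>

section \<open>A Hoeffding bound for finite products\<close>

text \<open>The factor 2^(8k) is 16^k twice. With \<delta> = 4^-k, squared inner products that
  differ by order \<delta> take order 16^k swap tests; each test costs O(log n + k) qubits, and the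
  second 16^k only absorbs the additive k. Without the common component the inner products would
  themselves be of order \<delta>, their squares would differ by order \<delta>^2 only, and the
  256^k tests then needed would leave no room for that k.

  The simultaneous protocol has no shared randomness: since f and the entangled protocol are fixed,
  one family of sign vectors that is good for all pairs of inputs is chosen once and built into both
  encodings. A sign sum of a unit vector can be as large as the square root of the dimension, which
  is unbounded here, and the tail bound for bounded variables would then depend on that dimension.
  Hence the truncation, whose cost is paid by fourth moments. Probabilities appear only as finite
  weighted sums.\<close>

lemma exp_le_quadratic:
  fixes x :: real
  assumes "\<bar>x\<bar> \<le> 1"
  shows "exp x \<le> 1 + x + x\<^sup>2"
proof (cases "x \<ge> 0")
  case True
  then show ?thesis using exp_bound[of x] assms by simp
next
  case False
  \<comment> \<open>For negative x, (1 + x + x^2)(1 - x) = 1 - x^3 is at least 1, and the factor 1 -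
    x <= exp (-x) then cancels against exp x.\<close>
  have "1 * exp x \<le> (1 + x + x\<^sup>2) * (1 - x) * exp x"
  proof (intro mult_right_mono)
    have "x ^ 3 \<le> 0" using False by (simp add: power_le_zero_eq)
    then show "1 \<le> (1 + x + x\<^sup>2) * (1 - x)"
      by (simp add: algebra_simps power2_eq_square power3_eq_cube)
  qed simp
  also have "\<dots> = (1 + x + x\<^sup>2) * ((1 - x) * exp x)"
    by simp
  also have "\<dots> \<le> (1 + x + x\<^sup>2) * (exp (- x) * exp x)"
  proof (intro mult_left_mono mult_right_mono)
    show "1 - x \<le> exp (- x)" using exp_ge_add_one_self[of "-x"] by simp
    have "1 + x + x\<^sup>2 = (x + 1/2)\<^sup>2 + 3/4" by (simp add: power2_eq_square algebra_simps)
    then show "0 \<le> 1 + x + x\<^sup>2" by simp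
  qed simp
  finally show ?thesis by (simp add: exp_minus)
qed

text \<open>After centring, the linear term of the quadratic bound averages to 0 and the quadratic
  one to l^2 times a variance of at most 1. Since |h y - E| can reach 2, l <= 1/2 keeps the exponent
  in the range of \<open>exp_le_quadratic\<close>.\<close>

lemma exp_moment_le:
  fixes r h :: "'a \<Rightarrow> real"
  assumes fin: "finite Y" and r: "\<And>y. y \<in> Y \<Longrightarrow> r y \<ge> 0" "sum r Y = 1"
    and h: "\<And>y. y \<in> Y \<Longrightarrow> \<bar>h y\<bar> \<le> 1" and l: "0 \<le> l" "l \<le> 1/2"
  defines "E \<equiv> \<Sum>y\<in>Y. r y * h y"
  shows "(\<Sum>y\<in>Y. r y * exp (l * (h y - E))) \<le> exp (l\<^sup>2)"
proof -
  have "\<bar>E\<bar> \<le> (\<Sum>y\<in>Y. \<bar>r y * h y\<bar>)" unfolding E_def by (rule sum_abs)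
  also have "\<dots> \<le> (\<Sum>y\<in>Y. r y)"
    using r h by (intro sum_mono) (auto simp: abs_mult intro: mult_left_le)
  finally have E: "\<bar>E\<bar> \<le> 1" using r by simp
  have "(\<Sum>y\<in>Y. r y * exp (l * (h y - E))) \<le>
      (\<Sum>y\<in>Y. r y * (1 + l * (h y - E) + (l * (h y - E))\<^sup>2))"
  proof (intro sum_mono mult_left_mono exp_le_quadratic)
    fix y assume y: "y \<in> Y"
    have "\<bar>l * (h y - E)\<bar> \<le> 1/2 * 2"
      unfolding abs_mult using h[OF y] E l by (intro mult_mono) auto
    then show "\<bar>l * (h y - E)\<bar> \<le> 1" by simp
  qed (use r in auto)
  also have "\<dots> = sum r Y + l * (E - E * sum r Y) +
      l\<^sup>2 * ((\<Sum>y\<in>Y. r y * (h y)\<^sup>2) - 2 * E * E + E\<^sup>2 * sum r Y)"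
  proof -
    have E': "E = (\<Sum>y\<in>Y. h y * r y)" by (simp add: E_def mult.commute)
    have E'': "E * 2 = (\<Sum>y\<in>Y. h y * (r y * 2))"
      unfolding E' sum_distrib_right by (simp add: mult_ac)
    have "(\<Sum>y\<in>Y. r y * (1 + l * (h y - E) + (l * (h y - E))\<^sup>2)) =
      (\<Sum>y\<in>Y. r y + l * (r y * h y) - l * E * r y
        + l\<^sup>2 * (r y * (h y)\<^sup>2) - 2 * l\<^sup>2 * E * (r y * h y) + l\<^sup>2 * E\<^sup>2 * r y)"
      by (intro sum.cong) (auto simp: algebra_simps power2_eq_square)
    then show ?thesis
      by (simp add: sum.distrib sum_subtractf sum_distrib_left[symmetric] E'[symmetric] E''[symmetric]
        algebra_simps power2_eq_square)
  qed
  also have "\<dots> = 1 + l\<^sup>2 * ((\<Sum>y\<in>Y. r y * (h y)\<^sup>2) - E\<^sup>2)"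
    by (simp add: r power2_eq_square)
  also have "\<dots> \<le> 1 + l\<^sup>2 * 1"
  proof (intro add_left_mono mult_left_mono)
    have "(\<Sum>y\<in>Y. r y * (h y)\<^sup>2) \<le> (\<Sum>y\<in>Y. r y)"
      using r h by (intro sum_mono mult_left_le) (auto simp: abs_square_le_1)
    then show "(\<Sum>y\<in>Y. r y * (h y)\<^sup>2) - E\<^sup>2 \<le> 1" 
      using r(2) zero_le_power2[of E] by linarith
  qed simp
  also have "\<dots> \<le> exp (l\<^sup>2)" using exp_ge_add_one_self[of "l\<^sup>2"] by simp
  finally show ?thesis .
qed

text \<open>Chernoff's argument for the product measure with weights \<open>r\<close>: on the event
  the factor exp (l (sum - K E - K e)) is at least 1, and after extending the sum from
  \<open>G\<close> to all tuples it factors over the coordinates. \<open>G\<close> may be any set of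
  tuples inside the event, so the bound serves both for random sign vectors and for swap test
  outcomes.\<close>

lemma hoeffding_product:
  fixes r h :: "'a \<Rightarrow> real"
  assumes fin: "finite Y" and r: "\<And>y. y \<in> Y \<Longrightarrow> r y \<ge> 0" "sum r Y = 1"
    and h: "\<And>y. y \<in> Y \<Longrightarrow> \<bar>h y\<bar> \<le> 1" and e: "0 \<le> e" "e \<le> 1"
    and G: "G \<subseteq> {..<K} \<rightarrow>\<^sub>E Y"
      "\<And>g. g \<in> G \<Longrightarrow> (\<Sum>j<K. h (g j)) \<ge> real K * ((\<Sum>y\<in>Y. r y * h y) + e)"
  shows "(\<Sum>g\<in>G. \<Prod>j<K. r (g j)) \<le> exp (- (real K * e\<^sup>2 / 4))"
proof -
  define E where "E = (\<Sum>y\<in>Y. r y * h y)"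
  \<comment> \<open>The exponent to be minimised is K (l^2 - l e); its minimum - K e^2 / 4 is at l =
    e / 2.\<close>
  define l where "l = e / 2"
  have l: "0 \<le> l" "l \<le> 1/2" using e by (auto simp: l_def)
  have finP: "finite ({..<K} \<rightarrow>\<^sub>E Y)" using fin by (intro finite_PiE) auto
  have "(\<Sum>g\<in>G. \<Prod>j<K. r (g j)) \<le>
      (\<Sum>g\<in>G. exp (- (l * (K * e))) * (\<Prod>j<K. r (g j) * exp (l * (h (g j) - E))))"
  proof (intro sum_mono)
    fix g assume g: "g \<in> G"
    have pos: "(\<Prod>j<K. r (g j)) \<ge> 0"
      using g G(1) r(1) by (intro prod_nonneg) (auto simp: PiE_iff)
    have "1 \<le> exp (l * ((\<Sum>j<K. h (g j) - E) - K * e))"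
    proof -
      have "0 \<le> (\<Sum>j<K. h (g j) - E) - K * e"
        using G(2)[OF g] unfolding E_def[symmetric] by (simp add: sum_subtractf distrib_left)
      then show ?thesis using l by simp
    qed
    also have "\<dots> = exp (- (l * (K * e))) * (\<Prod>j<K. exp (l * (h (g j) - E)))"
      by (simp add: exp_sum[symmetric] exp_add[symmetric] sum_distrib_left sum_subtractf algebra_simps)
    finally have "(\<Prod>j<K. r (g j)) * 1 \<le> (\<Prod>j<K. r (g j)) * (exp (- (l * (K * e))) * (\<Prod>j<K. exp (l * (h (g j) - E))))"
      using pos by (intro mult_left_mono) auto
    then show "(\<Prod>j<K. r (g j)) \<le> exp (- (l * (K * e))) * (\<Prod>j<K. r (g j) * exp (l * (h (g j) - E)))"
      by (simp add: prod.distrib mult_ac)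
  qed
  also have "\<dots> \<le> (\<Sum>g\<in>{..<K} \<rightarrow>\<^sub>E Y. exp (- (l * (K * e))) * (\<Prod>j<K. r (g j) * exp (l * (h (g j) - E))))"
    using finP G(1) r(1)
    by (intro sum_mono2) (auto simp: PiE_iff intro!: mult_nonneg_nonneg prod_nonneg)
  also have "\<dots> = exp (- (l * (K * e))) * (\<Prod>j<K. \<Sum>y\<in>Y. r y * exp (l * (h y - E)))"
    by (subst prod_sum_PiE) (use fin in \<open>auto simp: sum_distrib_left\<close>)
  also have "\<dots> \<le> exp (- (l * (K * e))) * (\<Prod>j<K. exp (l\<^sup>2))"
  proof (intro mult_left_mono prod_mono conjI)
    show "(\<Sum>y\<in>Y. r y * exp (l * (h y - E))) \<le> exp (l\<^sup>2)"
      unfolding E_def by (rule exp_moment_le) (use fin r h l in auto)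
  qed (use r in \<open>auto intro!: sum_nonneg\<close>)
  also have "\<dots> = exp (- (real K * e\<^sup>2 / 4))"
    by (simp add: exp_of_nat_mult[symmetric] exp_add[symmetric] l_def power2_eq_square field_simps)
  finally show ?thesis .
qed

text \<open>Union bound: if every tuple failed for some i, the bad events would cover the whole
  product space, whose total weight 1 would be at most \<open>card I\<close> times the tail
  bound.\<close>

lemma exists_good_sample:
  fixes h :: "'i \<Rightarrow> 'a \<Rightarrow> real"
  assumes fin: "finite Y" "Y \<noteq> {}" "finite I"
    and h: "\<And>i y. i \<in> I \<Longrightarrow> y \<in> Y \<Longrightarrow> \<bar>h i y\<bar> \<le> 1" and e: "0 \<le> e" "e \<le> 1"
    and T: "real (card I) * exp (- (real T * e\<^sup>2 / 4)) < 1"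
  shows "\<exists>g\<in>{..<T} \<rightarrow>\<^sub>E Y. \<forall>i\<in>I.
    (\<Sum>t<T. h i (g t)) < real T * ((\<Sum>y\<in>Y. h i y) / real (card Y) + e)"
proof (rule ccontr)
  assume neg: "\<not> ?thesis"
  define r where "r = (\<lambda>y::'a. 1 / real (card Y))"
  define B where "B = (\<lambda>i. {g \<in> {..<T} \<rightarrow>\<^sub>E Y. 
    (\<Sum>t<T. h i (g t)) \<ge> real T * ((\<Sum>y\<in>Y. r y * h i y) + e)})"
  have finP: "finite ({..<T} \<rightarrow>\<^sub>E Y)" using fin by (intro finite_PiE) auto
  have r: "r y \<ge> 0" "sum r Y = 1" for y using fin by (auto simp: r_def)
  have cover: "{..<T} \<rightarrow>\<^sub>E Y \<subseteq> (\<Union>i\<in>I. B i)"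
    using neg by (fastforce simp: B_def r_def sum_divide_distrib[symmetric] not_less)
  have "1 = (\<Prod>t<T. \<Sum>y\<in>Y. r y)" using r by simp
  also have "\<dots> = (\<Sum>g\<in>{..<T} \<rightarrow>\<^sub>E Y. \<Prod>t<T. r (g t))"
    by (rule prod_sum_PiE) (use fin in auto)
  also have "\<dots> \<le> (\<Sum>g\<in>{..<T} \<rightarrow>\<^sub>E Y. \<Sum>i\<in>I. if g \<in> B i then \<Prod>t<T. r (g t) else 0)"
  proof (intro sum_mono)
    fix g assume "g \<in> {..<T} \<rightarrow>\<^sub>E Y"
    then obtain i where i: "i \<in> I" "g \<in> B i" using cover by auto
    then show "(\<Prod>t<T. r (g t)) \<le> (\<Sum>i\<in>I. if g \<in> B i then \<Prod>t<T. r (g t) else 0)"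
      using member_le_sum[of i I "\<lambda>i. if g \<in> B i then \<Prod>t<T. r (g t) else 0"] fin r
      by (auto simp: prod_nonneg)
  qed
  also have "\<dots> = (\<Sum>i\<in>I. \<Sum>g\<in>B i. \<Prod>t<T. r (g t))"
    by (subst sum.swap) (auto simp: B_def sum.inter_filter[OF finP] intro!: sum.cong)
  also have "\<dots> \<le> (\<Sum>i\<in>I. exp (- (real T * e\<^sup>2 / 4)))"
  proof (intro sum_mono)
    fix i assume "i \<in> I"
    then show "(\<Sum>g\<in>B i. \<Prod>t<T. r (g t)) \<le> exp (- (real T * e\<^sup>2 / 4))"
      by (intro hoeffding_product[where h = "h i"]) (use fin r h e in \<open>auto simp: B_def\<close>)
  qed
  also have "\<dots> < 1" using T by simp
  finally show False by simp
qed

section \<open>Dimension reduction by random signs\<close>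

text \<open>A sign vector is encoded by the set \<open>A\<close> of indices with sign +, so that
  averaging over \<open>Pow J\<close> is the expectation over independent uniform signs.\<close>

definition signed_sum :: "('a \<Rightarrow> real) \<Rightarrow> 'a set \<Rightarrow> 'a set \<Rightarrow> real" where
  "signed_sum a J A = (\<Sum>j\<in>J. if j \<in> A then a j else - a j)"

lemma sum_Pow_insert:
  assumes "finite J" "j \<notin> J"
  shows "sum g (Pow (insert j J)) = (\<Sum>A\<in>Pow J. g A + g (insert j A))"
proof -
  have "sum g (Pow (insert j J)) = sum g (Pow J) + sum g (insert j ` Pow J)"
    unfolding Pow_insert by (rule sum.union_disjoint) (use assms in auto)
  also have "sum g (insert j ` Pow J) = (\<Sum>A\<in>Pow J. g (insert j A))"
    using assms by (subst sum.reindex) (auto simp: inj_on_def)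
  finally show ?thesis by (simp add: sum.distrib)
qed

lemma signed_sum_insert:
  assumes "finite J" "j \<notin> J" "A \<subseteq> J"
  shows "signed_sum a (insert j J) A = signed_sum a J A - a j"
    and "signed_sum a (insert j J) (insert j A) = signed_sum a J A + a j"
proof -
  have "(\<Sum>i\<in>J. if i = j \<or> i \<in> A then a i else - a i) = (\<Sum>i\<in>J. if i \<in> A then a i else - a i)"
    using assms by (intro sum.cong) auto
  then show "signed_sum a (insert j J) A = signed_sum a J A - a j"
    "signed_sum a (insert j J) (insert j A) = signed_sum a J A + a j"
    using assms by (auto simp: signed_sum_def)
qed

text \<open>Mixed terms cancel between the two signs of an inserted index: (s - a)(t - b) + (s +
  a)(t + b) = 2 s t + 2 a b.\<close>

lemma signed_sum_product:
  assumes "finite J"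
  shows "(\<Sum>A\<in>Pow J. signed_sum a J A * signed_sum b J A) = 2 ^ card J * (\<Sum>j\<in>J. a j * b j)"
  using assms
proof induction
  case empty
  then show ?case by (simp add: signed_sum_def)
next
  case (insert j J)
  have "(\<Sum>A\<in>Pow (insert j J). signed_sum a (insert j J) A * signed_sum b (insert j J) A) =
      (\<Sum>A\<in>Pow J. 2 * (signed_sum a J A * signed_sum b J A) + 2 * (a j * b j))"
    unfolding sum_Pow_insert[OF insert(1,2)]
    by (intro sum.cong) (use insert in \<open>auto simp: signed_sum_insert algebra_simps\<close>)
  also have "\<dots> = 2 ^ card (insert j J) * (\<Sum>j\<in>insert j J. a j * b j)"
    using insert by (simp add: sum.distrib sum_distrib_left[symmetric] card_Pow algebra_simps)
  finally show ?case .
qed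

text \<open>The two signs of an inserted index give (s + a)^4 + (s - a)^4 = 2 s^4 + 12 a^2 s^2 + 2
  a^4, and the second moment of s is known. The constant 3 is that of a Gaussian variable and does
  not depend on the dimension.\<close>

lemma signed_sum_fourth_moment:
  assumes "finite J"
  shows "(\<Sum>A\<in>Pow J. signed_sum a J A ^ 4) \<le> 2 ^ card J * (3 * (\<Sum>j\<in>J. (a j)\<^sup>2)\<^sup>2)"
  using assms
proof induction
  case empty
  then show ?case by (simp add: signed_sum_def)
next
  case (insert j J)
  define S where "S = (\<Sum>j\<in>J. (a j)\<^sup>2)"
  have "(\<Sum>A\<in>Pow (insert j J). signed_sum a (insert j J) A ^ 4) =
      (\<Sum>A\<in>Pow J. 2 * signed_sum a J A ^ 4 + 12 * (a j)\<^sup>2 * (signed_sum a J A * signed_sum a J A) + 2 * a j ^ 4)"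
    unfolding sum_Pow_insert[OF insert(1,2)]
    by (intro sum.cong) (use insert in \<open>auto simp: signed_sum_insert algebra_simps power2_eq_square power4_eq_xxxx\<close>)
  also have "\<dots> = 2 * (\<Sum>A\<in>Pow J. signed_sum a J A ^ 4) + 12 * (a j)\<^sup>2 * (2 ^ card J * S) + 2 * (2 ^ card J * a j ^ 4)"
    using insert signed_sum_product[OF insert(1), of a a]
    by (simp add: sum.distrib sum_distrib_left[symmetric] card_Pow S_def power2_eq_square)
  \<comment> \<open>Raising the coefficient of a^4 from 1 to 3 completes the square 3 (S +
    a^2)^2.\<close>
  also have "\<dots> \<le> 2 * (2 ^ card J * (3 * S\<^sup>2)) + 12 * (a j)\<^sup>2 * (2 ^ card J * S) + 2 * (2 ^ card J * (3 * a j ^ 4))"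
    using insert.IH by (intro add_mono mult_left_mono) (auto simp: S_def)
  also have "\<dots> = 2 ^ card (insert j J) * (3 * (\<Sum>j\<in>insert j J. (a j)\<^sup>2)\<^sup>2)"
  proof -
    have *: "(\<Sum>j\<in>insert j J. (a j)\<^sup>2) = S + (a j)\<^sup>2" and **: "card (insert j J) = Suc (card J)"
      using insert by (auto simp: S_def)
    show ?thesis unfolding * ** by (simp add: algebra_simps power2_eq_square power4_eq_xxxx)
  qed
  finally show ?case .
qed

section \<open>Truncation of the sign sums\<close>

definition truncate :: "real \<Rightarrow> real \<Rightarrow> real" where
  "truncate B u = (if \<bar>u\<bar> \<le> B then u else 0)"

text \<open>Large values are set to 0 and not clamped, so the truncated product is either u v or 0,
  and an error |u v| occurs only if one of the factors, s, exceeds B in absolute value. Then |s t|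
  <= s^2 |t| / B for the other factor t, and 2 s^2 |t| <= s^4 + t^2.\<close>

lemma truncate_product_error:
  assumes "B > 0"
  shows "\<bar>truncate B u * truncate B v - u * v\<bar> \<le> (u ^ 4 + u\<^sup>2 + v ^ 4 + v\<^sup>2) / (2 * B)"
proof -
  have key: "\<bar>s * t\<bar> \<le> (s ^ 4 + t\<^sup>2) / (2 * B)" if "\<bar>s\<bar> > B" for s t :: real
  proof -
    have "2 * B * \<bar>s * t\<bar> \<le> 2 * \<bar>s\<bar> * \<bar>s * t\<bar>"
      using that by (intro mult_right_mono) auto
    also have "\<dots> = 2 * s\<^sup>2 * \<bar>t\<bar>" by (simp add: abs_mult power2_eq_square)
    also have "\<dots> \<le> (s\<^sup>2)\<^sup>2 + \<bar>t\<bar>\<^sup>2" by (rule sum_squares_bound)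
    finally show ?thesis using assms by (simp add: field_simps)
  qed
  have nn: "0 \<le> (s ^ 4 + t\<^sup>2) / (2 * B)" for s t :: real using assms by simp
  have split: "(u ^ 4 + u\<^sup>2 + v ^ 4 + v\<^sup>2) / (2 * B) =
      (u ^ 4 + v\<^sup>2) / (2 * B) + (v ^ 4 + u\<^sup>2) / (2 * B)"
    unfolding add_divide_distrib[symmetric] by (simp add: add_ac)
  have vu: "\<bar>v * u\<bar> = \<bar>u * v\<bar>" by (simp add: mult.commute)
  consider "\<bar>u\<bar> \<le> B" "\<bar>v\<bar> \<le> B" | "\<bar>u\<bar> > B" | "\<bar>v\<bar> > B" by linarith
  then show ?thesis
  proof cases
    case 1
    then show ?thesis using nn[of u v] nn[of v u] unfolding split by (simp add: truncate_def)
  next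
    case 2
    then show ?thesis using key[of u v] nn[of v u] unfolding split by (simp add: truncate_def)
  next
    case 3
    then show ?thesis using key[of v u] nn[of u v] unfolding split vu by (simp add: truncate_def)
  qed
qed

text \<open>The averages of fourth and second powers are at most 3 and 1, so the error is at most (3
  + 1 + 3 + 1) / (2 B), whatever the size of \<open>J\<close>.\<close>

lemma signed_sum_truncate_product:
  assumes "finite J" "B > 0" "(\<Sum>j\<in>J. (a j)\<^sup>2) \<le> 1" "(\<Sum>j\<in>J. (b j)\<^sup>2) \<le> 1"
  shows "\<bar>(\<Sum>A\<in>Pow J. truncate B (signed_sum a J A) * truncate B (signed_sum b J A)) / 2 ^ card J
    - (\<Sum>j\<in>J. a j * b j)\<bar> \<le> 4 / B"
proof -
  have 4: "(\<Sum>A\<in>Pow J. signed_sum c J A ^ 4) \<le> 2 ^ card J * 3" if "(\<Sum>j\<in>J. (c j)\<^sup>2) \<le> 1" for c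
  proof -
    have "(\<Sum>j\<in>J. (c j)\<^sup>2)\<^sup>2 \<le> 1" using that by (intro power_le_one) (auto intro: sum_nonneg)
    then have "2 ^ card J * (3 * (\<Sum>j\<in>J. (c j)\<^sup>2)\<^sup>2) \<le> 2 ^ card J * (3 * 1::real)"
      by (intro mult_left_mono) auto
    then show ?thesis using signed_sum_fourth_moment[OF assms(1), of c] by linarith
  qed
  have 2: "(\<Sum>A\<in>Pow J. (signed_sum c J A)\<^sup>2) \<le> 2 ^ card J" if "(\<Sum>j\<in>J. (c j)\<^sup>2) \<le> 1" for c
    using that signed_sum_product[OF assms(1), of c c] by (simp add: power2_eq_square)
  have "\<bar>(\<Sum>A\<in>Pow J. truncate B (signed_sum a J A) * truncate B (signed_sum b J A))
      - (\<Sum>A\<in>Pow J. signed_sum a J A * signed_sum b J A)\<bar> \<le>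
    (\<Sum>A\<in>Pow J. \<bar>truncate B (signed_sum a J A) * truncate B (signed_sum b J A)
      - signed_sum a J A * signed_sum b J A\<bar>)"
    unfolding sum_subtractf[symmetric] by (rule sum_abs)
  also have "\<dots> \<le> (\<Sum>A\<in>Pow J. (signed_sum a J A ^ 4 + (signed_sum a J A)\<^sup>2 + signed_sum b J A ^ 4
      + (signed_sum b J A)\<^sup>2) / (2 * B))"
    by (intro sum_mono truncate_product_error assms)
  also have "\<dots> \<le> (2 ^ card J * 3 + 2 ^ card J + 2 ^ card J * 3 + 2 ^ card J) / (2 * B)"
    unfolding sum_divide_distrib[symmetric] sum.distrib
    by (intro divide_right_mono add_mono 2 4) (use assms in auto)
  also have "\<dots> = 2 ^ card J * (4 / B)" by (simp add: field_simps)
  finally show ?thesis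
    unfolding signed_sum_product[OF assms(1)]
    by (simp add: field_simps abs_le_iff)
qed

text \<open>The new coordinates are truncated sign sums for \<open>T\<close> sampled sign vectors,
  divided by the root of \<open>T\<close>. Squared norms are sampled quantities too, hence the bound
  2 in place of 1. The bound on \<open>T\<close> involves n and \<eta> but not the size of
  \<open>J\<close>.\<close>

lemma dimension_reduction:
  fixes a b :: "'x \<Rightarrow> 'j \<Rightarrow> real"
  assumes fin: "finite J" "finite X" and X: "card X \<le> 2 ^ n"
    and a: "\<And>x. x \<in> X \<Longrightarrow> (\<Sum>j\<in>J. (a x j)\<^sup>2) \<le> 1"
    and b: "\<And>y. y \<in> X \<Longrightarrow> (\<Sum>j\<in>J. (b y j)\<^sup>2) \<le> 1"
    and eta: "0 < \<eta>" "\<eta> \<le> 1" and T: "real T \<ge> 8 * real (n + 2) * 128\<^sup>2 / \<eta> ^ 6"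
  obtains w z :: "'x \<Rightarrow> nat \<Rightarrow> real"
  where "\<And>x. x \<in> X \<Longrightarrow> (\<Sum>t<T. (w x t)\<^sup>2) \<le> 2"
    and "\<And>y. y \<in> X \<Longrightarrow> (\<Sum>t<T. (z y t)\<^sup>2) \<le> 2"
    and "\<And>x y. x \<in> X \<Longrightarrow> y \<in> X \<Longrightarrow>
      \<bar>(\<Sum>t<T. w x t * z y t) - (\<Sum>j\<in>J. a x j * b y j)\<bar> \<le> \<eta>"
proof -
  \<comment> \<open>The error \<eta> is split evenly: truncation costs 4 / B = \<eta> / 2, and
    sampling costs B^2 e = \<eta> / 2 because products are divided by B^2 before the tail bound is
    applied.\<close>
  define B where "B = 8 / \<eta>"
  define e where "e = \<eta> ^ 3 / 128"
  have B: "B > 0" using eta by (auto simp: B_def)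
  have eta3: "0 < \<eta> ^ 3" "\<eta> ^ 3 \<le> 1" using eta by (auto intro: power_le_one)
  have e: "0 < e" "e \<le> 1" using eta3 by (auto simp: e_def)
  have Be: "B\<^sup>2 * e = \<eta> / 2" using eta by (simp add: B_def e_def field_simps power2_eq_square power3_eq_cube)
  have "real T \<ge> 8 * real (n + 2) / e\<^sup>2"
    using T eta by (simp add: e_def power_divide power_mult[symmetric] field_simps)
  then have T': "real T * e\<^sup>2 / 4 \<ge> 2 * real (n + 2)" using e by (simp add: field_simps)
  have "0 < 8 * real (n + 2) * 128\<^sup>2 / \<eta> ^ 6" using eta by auto
  with T have Tpos: "real T > 0" by linarith
  define F where "F = (\<lambda>x A. truncate B (signed_sum (a x) J A))"
  define G where "G = (\<lambda>x A. truncate B (signed_sum (b x) J A))"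
  have trunc: "\<bar>truncate B u\<bar> \<le> B" "\<bar>truncate B u\<bar> \<le> \<bar>u\<bar>" for u 
    using B by (auto simp: truncate_def)
  have prod_le: "\<bar>truncate B u * truncate B v / B\<^sup>2\<bar> \<le> 1" for u v
  proof -
    have "\<bar>truncate B u\<bar> * \<bar>truncate B v\<bar> \<le> B * B"
      using trunc B by (intro mult_mono) auto
    then show ?thesis using B by (simp add: abs_mult power2_eq_square)
  qed
  \<comment> \<open>The tag c selects what has to be controlled: the product from above, the product
    from below through its negative, and the squared norms of either side.\<close>
  define h :: "nat \<times> 'x \<times> 'x \<Rightarrow> 'j set \<Rightarrow> real" where
    "h = (\<lambda>(c, x, y) A. (if c = 0 then F x A * G y A else if c = 1 then - (F x A * G y A)
       else if c = 2 then F x A * F x A else G x A * G x A) / B\<^sup>2)"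
  define I where "I = {..<4::nat} \<times> X \<times> X"
  have hb: "\<bar>h i A\<bar> \<le> 1" for i A
    using prod_le by (cases i) (auto simp: h_def F_def G_def simp del: abs_divide intro: abs_le_D1)
  have "\<exists>g\<in>{..<T} \<rightarrow>\<^sub>E Pow J. \<forall>i\<in>I.
    (\<Sum>t<T. h i (g t)) < real T * ((\<Sum>A\<in>Pow J. h i A) / real (card (Pow J)) + e)"
  proof (rule exists_good_sample)
    \<comment> \<open>There are at most 4 * 4^n events, each of weight at most exp (- 2 (n + 2)) <=
      4^-(n + 2); the total is at most 1/4.\<close>
    have "real (card I) * exp (- (real T * e\<^sup>2 / 4)) \<le> (4 * (2 ^ n * 2 ^ n)) * exp (- (2 * real (n + 2)))"
    proof (intro mult_mono)
      have "real (card X) \<le> real (2 ^ n)" using X by (rule of_nat_mono)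
      then have "real (card X) \<le> 2 ^ n" by simp
      then show "real (card I) \<le> 4 * (2 ^ n * 2 ^ n)"
        by (auto simp: I_def card_cartesian_product intro!: mult_mono)
    qed (use T' in auto)
    also have "\<dots> = 2 ^ (2 * (n + 1)) * exp (- 1) ^ (2 * (n + 2))"
    proof -
      have "exp (- (2 * real (n + 2))) = exp (- 1) ^ (2 * (n + 2))"
        using exp_of_nat_mult[of "2 * (n + 2)" "- 1 :: real"] by (simp add: algebra_simps)
      moreover have "4 * (2 ^ n * 2 ^ n) = (2 :: real) ^ (2 * (n + 1))"
        by (simp add: power_mult power_mult_distrib[symmetric])
      ultimately show ?thesis by (simp only:)
    qed
    also have "\<dots> < 1"
    proof -
      have "2 ^ (2 * (n + 1)) * exp (- 1) ^ (2 * (n + 2)) \<le> 2 ^ (2 * (n + 1)) * (1/2 :: real) ^ (2 * (n + 2))"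
        using exp_ge_add_one_self[of 1]
        by (intro mult_left_mono power_mono) (auto simp: exp_minus field_simps)
      also have "\<dots> < 1" by (simp add: power_add power_one_over field_simps)
      finally show ?thesis .
    qed
    finally show "real (card I) * exp (- (real T * e\<^sup>2 / 4)) < 1" .
  qed (use fin e hb in \<open>auto simp: I_def\<close>)
  then obtain g where g: "\<And>c x y. c < 4 \<Longrightarrow> x \<in> X \<Longrightarrow> y \<in> X \<Longrightarrow>
    (\<Sum>t<T. h (c, x, y) (g t)) < real T * ((\<Sum>A\<in>Pow J. h (c, x, y) A) / 2 ^ card J + e)"
    using fin by (force simp: I_def card_Pow)
  have scale: "(\<Sum>t<T. u t) / T < (\<Sum>A\<in>Pow J. v A) / 2 ^ card J + \<eta> / 2"
    if "(\<Sum>t<T. u t / B\<^sup>2) < real T * ((\<Sum>A\<in>Pow J. v A / B\<^sup>2) / 2 ^ card J + e)" for u v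
  proof -
    have "B\<^sup>2 * (\<Sum>t<T. u t / B\<^sup>2) < B\<^sup>2 * (real T * ((\<Sum>A\<in>Pow J. v A / B\<^sup>2) / 2 ^ card J + e))"
      using that B by (intro mult_strict_left_mono) auto
    also have "B\<^sup>2 * (real T * ((\<Sum>A\<in>Pow J. v A / B\<^sup>2) / 2 ^ card J + e)) =
        real T * ((\<Sum>A\<in>Pow J. v A) / 2 ^ card J + B\<^sup>2 * e)"
      using B by (simp add: sum_divide_distrib[symmetric] distrib_left)
    also have "B\<^sup>2 * (\<Sum>t<T. u t / B\<^sup>2) = (\<Sum>t<T. u t)"
      using B by (simp add: sum_divide_distrib[symmetric])
    finally have "(\<Sum>t<T. u t) < real T * ((\<Sum>A\<in>Pow J. v A) / 2 ^ card J + \<eta> / 2)"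
      unfolding Be .
    then show ?thesis using Tpos by (simp add: field_simps)
  qed
  \<comment> \<open>Truncation can only lower the second moment, so the average over all sign
    vectors is at most 1 and the sampled one at most 1 + \<eta> / 2.\<close>
  have sq: "(\<Sum>t<T. (truncate B (signed_sum c J (g t)) / sqrt T)\<^sup>2) \<le> 2"
    if c: "(\<Sum>j\<in>J. (c j)\<^sup>2) \<le> 1" and less: "(\<Sum>t<T. truncate B (signed_sum c J (g t)) * truncate B (signed_sum c J (g t))) / T
       < (\<Sum>A\<in>Pow J. truncate B (signed_sum c J A) * truncate B (signed_sum c J A)) / 2 ^ card J + \<eta> / 2" for c
  proof -
    have "(\<Sum>A\<in>Pow J. truncate B (signed_sum c J A) * truncate B (signed_sum c J A)) \<le>
       (\<Sum>A\<in>Pow J. signed_sum c J A * signed_sum c J A)"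
      using trunc(2) by (intro sum_mono) (metis abs_ge_zero abs_mult_self_eq mult_mono)
    also have "\<dots> \<le> 2 ^ card J"
      using c signed_sum_product[OF fin(1), of c c] by (simp add: power2_eq_square)
    finally have "(\<Sum>A\<in>Pow J. truncate B (signed_sum c J A) * truncate B (signed_sum c J A)) / 2 ^ card J \<le> 1"
      by simp
    with less eta have "(\<Sum>t<T. truncate B (signed_sum c J (g t)) * truncate B (signed_sum c J (g t))) / T \<le> 2"
      by linarith
    then show ?thesis using Tpos
      by (simp add: power_divide sum_divide_distrib[symmetric] power2_eq_square[symmetric])
  qed
  show thesis
  proof (rule that[of "\<lambda>x t. F x (g t) / sqrt T" "\<lambda>x t. G x (g t) / sqrt T"])
    fix x assume x: "x \<in> X"
    show "(\<Sum>t<T. (F x (g t) / sqrt T)\<^sup>2) \<le> 2"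
      unfolding F_def
      by (rule sq[OF a[OF x] scale]) (use g[of 2 x x] x in \<open>simp add: h_def F_def\<close>)
    show "(\<Sum>t<T. (G x (g t) / sqrt T)\<^sup>2) \<le> 2"
      unfolding G_def
      by (rule sq[OF b[OF x] scale]) (use g[of 3 x x] x in \<open>simp add: h_def G_def\<close>)
    fix y assume y: "y \<in> X"
    have 1: "(\<Sum>t<T. F x (g t) * G y (g t)) / T < (\<Sum>A\<in>Pow J. F x A * G y A) / 2 ^ card J + \<eta> / 2"
      by (rule scale) (use g[of 0 x y] x y in \<open>simp add: h_def\<close>)
    have 2: "(\<Sum>t<T. - (F x (g t) * G y (g t))) / T < (\<Sum>A\<in>Pow J. - (F x A * G y A)) / 2 ^ card J + \<eta> / 2"
      by (rule scale) (use g[of 1 x y] x y in \<open>simp add: h_def\<close>)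
    have 3: "\<bar>(\<Sum>A\<in>Pow J. F x A * G y A) / 2 ^ card J - (\<Sum>j\<in>J. a x j * b y j)\<bar> \<le> \<eta> / 2"
      using signed_sum_truncate_product[OF fin(1) B a[OF x] b[OF y]] by (simp add: F_def G_def B_def)
    have "(\<Sum>t<T. F x (g t) / sqrt T * (G y (g t) / sqrt T)) = (\<Sum>t<T. F x (g t) * G y (g t)) / T"
      by (simp add: sum_divide_distrib)
    then show "\<bar>(\<Sum>t<T. F x (g t) / sqrt T * (G y (g t) / sqrt T)) - (\<Sum>j\<in>J. a x j * b y j)\<bar> \<le> \<eta>"
      using 1 2 3 unfolding abs_le_iff sum_negf by linarith
  qed
qed

section \<open>Operators on qubits\<close>

lemma finite_bits [simp]: "finite (bits N)"
  using finite_lists_length_eq[of "UNIV :: bool set" N] by (simp add: bits_def)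

definition op_mult :: "nat \<Rightarrow> qop \<Rightarrow> qop \<Rightarrow> qop" where
  "op_mult N X Y = (\<lambda>z w. \<Sum>u\<in>bits N. X z u * Y u w)"

definition adjoint :: "qop \<Rightarrow> qop" where
  "adjoint X = (\<lambda>z w. cnj (X w z))"

definition id_op :: qop where
  "id_op = (\<lambda>z w. if z = w then 1 else 0)"

definition norm_sq :: "nat \<Rightarrow> qstate \<Rightarrow> real" where
  "norm_sq N \<psi> = (\<Sum>z\<in>bits N. (cmod (\<psi> z))\<^sup>2)"

definition inner :: "nat \<Rightarrow> qstate \<Rightarrow> qstate \<Rightarrow> complex" where
  "inner N \<phi> \<psi> = (\<Sum>z\<in>bits N. cnj (\<phi> z) * \<psi> z)"

definition contraction :: "nat \<Rightarrow> qop \<Rightarrow> bool" where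
  "contraction N X \<longleftrightarrow> (\<forall>\<psi>. norm_sq N (app N X \<psi>) \<le> norm_sq N \<psi>)"

lemma inner_self: "inner N \<psi> \<psi> = complex_of_real (norm_sq N \<psi>)"
  by (simp add: inner_def norm_sq_def complex_norm_square mult.commute del: of_real_power)

lemma app_op_mult: "app N (op_mult N X Y) \<psi> = app N X (app N Y \<psi>)"
  unfolding app_def op_mult_def
  by (rule ext) (simp add: sum_distrib_left sum_distrib_right mult.assoc, rule sum.swap)

lemma op_mult_assoc: "op_mult N (op_mult N X Y) Z = op_mult N X (op_mult N Y Z)"
  unfolding op_mult_def
  by (intro ext) (simp add: sum_distrib_left sum_distrib_right mult.assoc, rule sum.swap)

text \<open>Operators are functions on all bit strings, but only the entries at strings of length
  \<open>N\<close> are meaningful. Identities such as commutation are known only there, so they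
  enter products through this rule and not by rewriting.\<close>

lemma op_mult_cong:
  assumes "\<And>z w. z \<in> bits N \<Longrightarrow> w \<in> bits N \<Longrightarrow> X z w = X' z w"
    and "\<And>z w. z \<in> bits N \<Longrightarrow> w \<in> bits N \<Longrightarrow> Y z w = Y' z w"
    and "z \<in> bits N" "w \<in> bits N"
  shows "op_mult N X Y z w = op_mult N X' Y' z w"
  unfolding op_mult_def using assms by (intro sum.cong) auto

lemma inner_app: "inner N (app N X \<phi>) \<psi> = inner N \<phi> (app N (adjoint X) \<psi>)"
  unfolding inner_def app_def adjoint_def
  by (simp add: sum_distrib_left sum_distrib_right mult_ac) (rule sum.swap)

lemma adjoint_adjoint [simp]: "adjoint (adjoint X) = X"
  by (simp add: adjoint_def)

lemma norm_sq_cong: "(\<And>z. z \<in> bits N \<Longrightarrow> \<phi> z = \<psi> z) \<Longrightarrow> norm_sq N \<phi> = norm_sq N \<psi>"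
  by (simp add: norm_sq_def)

lemma app_cong:
  assumes "\<And>z w. z \<in> bits N \<Longrightarrow> w \<in> bits N \<Longrightarrow> X z w = X' z w" "z \<in> bits N"
  shows "app N X \<psi> z = app N X' \<psi> z"
  unfolding app_def using assms by (intro sum.cong) auto

lemma re_inner_le: "2 * Re (inner N \<phi> \<psi>) \<le> norm_sq N \<phi> + norm_sq N \<psi>"
proof -
  have "2 * Re (cnj a * b) \<le> (cmod a)\<^sup>2 + (cmod b)\<^sup>2" for a b
    using sum_squares_bound[of "Re a" "Re b"] sum_squares_bound[of "Im a" "Im b"]
    by (simp add: cmod_power2)
  then show ?thesis
    unfolding inner_def norm_sq_def
    by (simp add: sum.distrib[symmetric] sum_distrib_left Re_sum sum_mono)
qed

text \<open>With \<chi> = X* \<phi>, the squared norm of \<chi> is Re <\<phi>, X \<chi>>, hence at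
  most half of |\<phi>|^2 + |X \<chi>|^2; as |X \<chi>| <= |\<chi>|, half of |\<chi>|^2 cancels. The
  inequality of the means replaces Cauchy-Schwarz.\<close>

lemma contraction_adjoint:
  assumes "contraction N X"
  shows "contraction N (adjoint X)"
  unfolding contraction_def
proof
  fix \<phi>
  let ?\<chi> = "app N (adjoint X) \<phi>"
  have "complex_of_real (norm_sq N ?\<chi>) = inner N \<phi> (app N X ?\<chi>)"
    by (simp add: inner_self[symmetric] inner_app)
  then have "norm_sq N ?\<chi> = Re (inner N \<phi> (app N X ?\<chi>))"
    by (metis Re_complex_of_real)
  moreover have "norm_sq N (app N X ?\<chi>) \<le> norm_sq N ?\<chi>"
    using assms by (auto simp: contraction_def)
  ultimately show "norm_sq N ?\<chi> \<le> norm_sq N \<phi>"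
    using re_inner_le[of N \<phi> "app N X ?\<chi>"] by linarith
qed

lemma contraction_op_mult:
  "contraction N X \<Longrightarrow> contraction N Y \<Longrightarrow> contraction N (op_mult N X Y)"
  unfolding contraction_def app_op_mult by (meson order_trans)

lemma app_id_op: "z \<in> bits N \<Longrightarrow> app N id_op \<psi> z = \<psi> z"
  by (simp add: app_def id_op_def if_distrib[of "\<lambda>a. a * _"] cong: if_cong)

lemma contraction_id_op: "contraction N id_op"
  unfolding contraction_def by (simp add: norm_sq_cong[OF app_id_op])

lemma unitary_op_adjoint_mult:
  assumes "unitary_op N U" "z \<in> bits N" "w \<in> bits N"
  shows "op_mult N (adjoint U) U z w = id_op z w"
  using assms by (simp add: unitary_op_def op_mult_def adjoint_def id_op_def)

lemma unitary_norm_sq: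
  assumes "unitary_op N U"
  shows "norm_sq N (app N U \<psi>) = norm_sq N \<psi>"
proof -
  have "complex_of_real (norm_sq N (app N U \<psi>)) = inner N \<psi> (app N (op_mult N (adjoint U) U) \<psi>)"
    by (simp add: inner_self[symmetric] inner_app app_op_mult)
  also have "\<dots> = inner N \<psi> (app N id_op \<psi>)"
    unfolding inner_def using unitary_op_adjoint_mult[OF assms]
    by (intro sum.cong refl arg_cong2[of _ _ _ _ "(*)"] app_cong)
  also have "\<dots> = inner N \<psi> \<psi>" unfolding inner_def by (intro sum.cong) (simp_all add: app_id_op)
  finally show ?thesis by (simp add: inner_self)
qed

lemma contraction_unitary: "unitary_op N U \<Longrightarrow> contraction N U"
  by (simp add: contraction_def unitary_norm_sq)

section \<open>Locality of operators\<close>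

definition mix :: "nat \<Rightarrow> nat set \<Rightarrow> bool list \<Rightarrow> bool list \<Rightarrow> bool list" where
  "mix N S z w = map (\<lambda>i. if i \<in> S then z ! i else w ! i) [0..<N]"

lemma mix_bits [simp]: "mix N S z w \<in> bits N"
  by (simp add: mix_def bits_def)

lemma mix_nth [simp]: "i < N \<Longrightarrow> mix N S z w ! i = (if i \<in> S then z ! i else w ! i)"
  by (simp add: mix_def)

lemma bits_eqI: "z \<in> bits N \<Longrightarrow> w \<in> bits N \<Longrightarrow> (\<And>i. i < N \<Longrightarrow> z ! i = w ! i) \<Longrightarrow> z = w"
  by (auto simp: bits_def intro: nth_equalityI)

lemma acts_onD1:
  "acts_on N S U \<Longrightarrow> z \<in> bits N \<Longrightarrow> w \<in> bits N \<Longrightarrow> \<not> agree_on ({0..<N} - S) z w \<Longrightarrow> U z w = 0"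
  unfolding acts_on_def by blast

lemma acts_onD2:
  "acts_on N S U \<Longrightarrow> z \<in> bits N \<Longrightarrow> w \<in> bits N \<Longrightarrow> z' \<in> bits N \<Longrightarrow> w' \<in> bits N \<Longrightarrow>
    agree_on S z z' \<Longrightarrow> agree_on S w w' \<Longrightarrow> agree_on ({0..<N} - S) z w \<Longrightarrow>
    agree_on ({0..<N} - S) z' w' \<Longrightarrow> U z w = U z' w'"
  unfolding acts_on_def by blast

lemma acts_on_mono:
  assumes "acts_on N S U" "S \<subseteq> S'" "S' \<subseteq> {0..<N}"
  shows "acts_on N S' U"
  unfolding acts_on_def
proof (intro conjI ballI impI)
  fix z w assume zw: "z \<in> bits N" "w \<in> bits N" "\<not> agree_on ({0..<N} - S') z w"
  then show "U z w = 0"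
    using assms by (intro acts_onD1[OF assms(1)]) (auto simp: agree_on_def)
next
  fix z w z' w' assume bits: "z \<in> bits N" "w \<in> bits N" "z' \<in> bits N" "w' \<in> bits N"
    and agree: "agree_on S' z z' \<and> agree_on S' w w' \<and> agree_on ({0..<N} - S') z w \<and> agree_on ({0..<N} - S') z' w'"
  show "U z w = U z' w'"
  proof (cases "agree_on ({0..<N} - S) z w")
    case True
    then have "agree_on ({0..<N} - S) z' w'"
      using agree assms unfolding agree_on_def by (metis Diff_iff)
    then show ?thesis using bits agree True assms(2)
      by (intro acts_onD2[OF assms(1)]) (auto simp: agree_on_def)
  next
    case False
    then have "\<not> agree_on ({0..<N} - S) z' w'"
      using agree assms unfolding agree_on_def by (metis Diff_iff)
    then show ?thesis using False bits acts_onD1[OF assms(1)] by metis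
  qed
qed

lemma acts_on_adjoint:
  assumes "acts_on N S U"
  shows "acts_on N S (adjoint U)"
  unfolding acts_on_def adjoint_def
proof (intro conjI ballI impI)
  fix z w assume zw: "z \<in> bits N" "w \<in> bits N" "\<not> agree_on ({0..<N} - S) z w"
  then show "cnj (U w z) = 0"
    using acts_onD1[OF assms zw(2,1)] by (auto simp: agree_on_def)
next
  fix z w z' w' assume "z \<in> bits N" "w \<in> bits N" "z' \<in> bits N" "w' \<in> bits N"
    and "agree_on S z z' \<and> agree_on S w w' \<and> agree_on ({0..<N} - S) z w \<and> agree_on ({0..<N} - S) z' w'"
  then show "cnj (U w z) = cnj (U w' z')"
    by (intro arg_cong[of _ _ cnj] acts_onD2[OF assms]) (auto simp: agree_on_def)
qed

text \<open>Only intermediate strings that agree with z outside \<open>S\<close> contribute.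
  Transplanting their \<open>S\<close>-part onto z' is a bijection with the strings that contribute
  to the entry at z' and w', and it preserves both factors.\<close>

lemma acts_on_op_mult:
  assumes X: "acts_on N S X" and Y: "acts_on N S Y" and S: "S \<subseteq> {0..<N}"
  shows "acts_on N S (op_mult N X Y)"
  unfolding acts_on_def op_mult_def
proof (intro conjI ballI impI)
  fix z w assume zw: "z \<in> bits N" "w \<in> bits N" "\<not> agree_on ({0..<N} - S) z w"
  have "X z u * Y u w = 0" if "u \<in> bits N" for u
  proof (cases "agree_on ({0..<N} - S) z u")
    case True
    then have "\<not> agree_on ({0..<N} - S) u w" using zw by (auto simp: agree_on_def)
    then show ?thesis using acts_onD1[OF Y that zw(2)] by simp
  qed (use acts_onD1[OF X zw(1) that] in simp)
  then show "(\<Sum>u\<in>bits N. X z u * Y u w) = 0" by (simp add: sum.neutral)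
next
  fix z w z' w' assume b: "z \<in> bits N" "w \<in> bits N" "z' \<in> bits N" "w' \<in> bits N"
    and ag: "agree_on S z z' \<and> agree_on S w w' \<and> agree_on ({0..<N} - S) z w \<and> agree_on ({0..<N} - S) z' w'"
  have restrict: "(\<Sum>u\<in>bits N. X z u * Y u w) = (\<Sum>u\<in>{u\<in>bits N. agree_on ({0..<N} - S) z u}. X z u * Y u w)"
    if "z \<in> bits N" for z w
    using acts_onD1[OF X that] by (intro sum.mono_neutral_right) auto
  show "(\<Sum>u\<in>bits N. X z u * Y u w) = (\<Sum>u\<in>bits N. X z' u * Y u w')"
    unfolding restrict[OF b(1)] restrict[OF b(3)]
  proof (intro sum.reindex_bij_witness[of _ "\<lambda>u. mix N S u z" "\<lambda>u. mix N S u z'"])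
    fix u assume u: "u \<in> {u \<in> bits N. agree_on ({0..<N} - S) z u}"
    show "mix N S (mix N S u z') z = u"
      using u by (intro bits_eqI[of _ N]) (auto simp: agree_on_def)
    show "mix N S u z' \<in> {u \<in> bits N. agree_on ({0..<N} - S) z' u}"
      by (auto simp: agree_on_def)
    have "X z' (mix N S u z') = X z u"
      using u b ag S by (intro acts_onD2[OF X]) (auto simp: agree_on_def)
    moreover have "Y (mix N S u z') w' = Y u w"
      using u b ag S by (intro acts_onD2[OF Y]) (auto simp: agree_on_def subset_iff)
    ultimately show "X z' (mix N S u z') * Y (mix N S u z') w' = X z u * Y u w" by simp
  next
    fix u assume u: "u \<in> {u \<in> bits N. agree_on ({0..<N} - S) z' u}"
    show "mix N S (mix N S u z) z' = u"
      using u by (intro bits_eqI[of _ N]) (auto simp: agree_on_def)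
    show "mix N S u z \<in> {u \<in> bits N. agree_on ({0..<N} - S) z u}"
      by (auto simp: agree_on_def)
  qed
qed

text \<open>A contributing intermediate string agrees with z outside \<open>S\<close> and with w
  outside \<open>S'\<close>, in particular on \<open>S\<close>; this determines it.\<close>

lemma op_mult_disjoint:
  assumes X: "acts_on N S X" and Y: "acts_on N S' Y" and S: "S \<inter> S' = {}"
    and b: "z \<in> bits N" "w \<in> bits N"
  shows "op_mult N X Y z w = X z (mix N S w z) * Y (mix N S w z) w"
proof -
  have "op_mult N X Y z w = (\<Sum>u\<in>{mix N S w z}. X z u * Y u w)"
    unfolding op_mult_def
  proof (intro sum.mono_neutral_right ballI)
    fix u assume u: "u \<in> bits N - {mix N S w z}"
    then obtain i where i: "i < N" "u ! i \<noteq> mix N S w z ! i"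
      using bits_eqI[of u N "mix N S w z"] by auto
    show "X z u * Y u w = 0"
    proof (cases "i \<in> S")
      case True
      then have "Y u w = 0" using u b i S by (intro acts_onD1[OF Y]) (auto simp: agree_on_def)
      then show ?thesis by simp
    next
      case False
      then have "X z u = 0" using u b i S by (intro acts_onD1[OF X]) (auto simp: agree_on_def)
      then show ?thesis by simp
    qed
  qed auto
  then show ?thesis by simp
qed

text \<open>Each of the two products has a single intermediate string. If z and w agree outside both
  sets, the factors match by locality, since only spectator qubits differ; otherwise both products
  vanish.\<close>

lemma op_mult_commute:
  assumes X: "acts_on N S X" and Y: "acts_on N S' Y" and S: "S \<inter> S' = {}" "S \<subseteq> {0..<N}" "S' \<subseteq> {0..<N}"
    and b: "z \<in> bits N" "w \<in> bits N"
  shows "op_mult N X Y z w = op_mult N Y X z w"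
proof (cases "agree_on ({0..<N} - S - S') z w")
  case True
  have "X z (mix N S w z) = X (mix N S' w z) w"
    using True S b by (intro acts_onD2[OF X]) (auto simp: agree_on_def subset_iff)
  moreover have "Y (mix N S w z) w = Y z (mix N S' w z)"
    using True S b by (intro acts_onD2[OF Y]) (auto simp: agree_on_def subset_iff)
  moreover have "S' \<inter> S = {}" using S by auto
  ultimately show ?thesis
    using op_mult_disjoint[OF X Y S(1) b] op_mult_disjoint[OF Y X _ b] by simp
next
  case False
  then have "\<not> agree_on ({0..<N} - S') (mix N S w z) w" "\<not> agree_on ({0..<N} - S) (mix N S' w z) w"
    by (auto simp: agree_on_def)
  moreover have "S' \<inter> S = {}" using S by auto
  ultimately show ?thesis
    using op_mult_disjoint[OF X Y S(1) b] op_mult_disjoint[OF Y X _ b]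
      acts_onD1[OF Y mix_bits b(2)] acts_onD1[OF X mix_bits b(2)] by simp
qed

section \<open>Factorization of entanglement-assisted protocols\<close>

text \<open>The matrix unit |b><b'| on qubit j, tensored with the identity on all other
  qubits.\<close>

definition unit_op :: "nat \<Rightarrow> bool \<Rightarrow> bool \<Rightarrow> qop" where
  "unit_op j b b' = (\<lambda>z w. if z ! j = b \<and> w = z[j := b'] then 1 else 0)"

text \<open>The block <b|Y|b'> with respect to qubit j, tensored with the identity on j. Keeping j
  as a spectator avoids renumbering the qubits.\<close>

definition block_op :: "nat \<Rightarrow> bool \<Rightarrow> bool \<Rightarrow> qop \<Rightarrow> qop" where
  "block_op j b b' Y = (\<lambda>z w. if z ! j = w ! j then Y (z[j := b]) (w[j := b']) else 0)"

lemma bits_update [simp]: "z \<in> bits N \<Longrightarrow> z[j := b] \<in> bits N"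
  by (simp add: bits_def)

lemma bits_update_nth: "z \<in> bits N \<Longrightarrow> i < N \<Longrightarrow> z[j := b] ! i = (if i = j then b else z ! i)"
  by (simp add: bits_def nth_list_update)

lemma bits_update_same: "z \<in> bits N \<Longrightarrow> j < N \<Longrightarrow> z ! j = b \<Longrightarrow> z[j := b] = z"
  using list_update_id[of z j] by simp

lemma app_unit_op:
  "z \<in> bits N \<Longrightarrow> app N (unit_op j b b') \<psi> z = (if z ! j = b then \<psi> (z[j := b']) else 0)"
  by (auto simp: app_def unit_op_def if_distrib[of "\<lambda>a. a * _"] cong: if_cong)

lemma op_mult_unit_op:
  "z \<in> bits N \<Longrightarrow> op_mult N (unit_op j b b') Y z w = (if z ! j = b then Y (z[j := b']) w else 0)"
  by (auto simp: op_mult_def unit_op_def if_distrib[of "\<lambda>a. a * _"] cong: if_cong)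

lemma acts_on_unit_op:
  assumes "j < N"
  shows "acts_on N {j} (unit_op j b b')"
  unfolding acts_on_def unit_op_def
proof (intro conjI ballI impI)
  fix z w assume zw: "z \<in> bits N" "w \<in> bits N" "\<not> agree_on ({0..<N} - {j}) z w"
  then show "(if z ! j = b \<and> w = z[j := b'] then 1 else 0) = (0 :: complex)"
    by (auto simp: agree_on_def bits_update_nth)
next
  fix z w z' w' assume b: "z \<in> bits N" "w \<in> bits N" "z' \<in> bits N" "w' \<in> bits N"
    and ag: "agree_on {j} z z' \<and> agree_on {j} w w' \<and> agree_on ({0..<N} - {j}) z w \<and> agree_on ({0..<N} - {j}) z' w'"
  have *: "v = u[j := b'] \<longleftrightarrow> v ! j = b'"
    if "u \<in> bits N" "v \<in> bits N" "agree_on ({0..<N} - {j}) u v" for u v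
  proof
    assume "v ! j = b'"
    then show "v = u[j := b']"
      using that by (intro bits_eqI[of _ N]) (auto simp: agree_on_def bits_update_nth)
  qed (use that assms in \<open>simp add: bits_update_nth\<close>)
  show "(if z ! j = b \<and> w = z[j := b'] then 1 else 0) = (if z' ! j = b \<and> w' = z'[j := b'] then 1 else (0 :: complex))"
    using ag *[OF b(1,2)] *[OF b(3,4)] by (auto simp: agree_on_def)
qed

lemma acts_on_block_op:
  assumes Y: "acts_on N S Y" and S: "j \<in> S" "S \<subseteq> {0..<N}"
  shows "acts_on N (S - {j}) (block_op j b b' Y)"
  unfolding acts_on_def block_op_def
proof (intro conjI ballI impI)
  fix z w assume zw: "z \<in> bits N" "w \<in> bits N" "\<not> agree_on ({0..<N} - (S - {j})) z w"
  then show "(if z ! j = w ! j then Y (z[j := b]) (w[j := b']) else 0) = 0"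
  proof (cases "z ! j = w ! j")
    case True
    moreover obtain i where "i \<in> {0..<N} - (S - {j})" "z ! i \<noteq> w ! i"
      using zw(3) unfolding agree_on_def by blast
    ultimately have "i < N" "i \<notin> S" "z ! i \<noteq> w ! i" "i \<noteq> j" by auto
    then have "\<not> agree_on ({0..<N} - S) (z[j := b]) (w[j := b'])"
      using zw(1,2) unfolding agree_on_def by (intro notI) (drule bspec[of _ _ i], auto simp: bits_update_nth)
    then show ?thesis using zw by (simp add: acts_onD1[OF Y])
  qed simp
next
  fix z w z' w' assume bts: "z \<in> bits N" "w \<in> bits N" "z' \<in> bits N" "w' \<in> bits N"
    and ag: "agree_on (S - {j}) z z' \<and> agree_on (S - {j}) w w' \<and> agree_on ({0..<N} - (S - {j})) z w
      \<and> agree_on ({0..<N} - (S - {j})) z' w'"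
  have jN: "j < N" using S by auto
  have "z ! j = w ! j" "z' ! j = w' ! j" using ag jN by (auto simp: agree_on_def)
  moreover have "Y (z[j := b]) (w[j := b']) = Y (z'[j := b]) (w'[j := b'])"
    using bts ag S by (intro acts_onD2[OF Y]) (auto simp: agree_on_def bits_update_nth subset_iff)
  ultimately show "(if z ! j = w ! j then Y (z[j := b]) (w[j := b']) else 0) =
      (if z' ! j = w' ! j then Y (z'[j := b]) (w'[j := b']) else 0)" by simp
qed

lemma norm_sq_unit_op:
  assumes "j < N"
  shows "norm_sq N (app N (unit_op j b b') \<psi>) = (\<Sum>w\<in>{w\<in>bits N. w ! j = b'}. (cmod (\<psi> w))\<^sup>2)"
proof -
  have "norm_sq N (app N (unit_op j b b') \<psi>) =
      (\<Sum>z\<in>bits N. if z ! j = b then (cmod (\<psi> (z[j := b'])))\<^sup>2 else 0)"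
    unfolding norm_sq_def by (intro sum.cong) (auto simp: app_unit_op)
  also have "\<dots> = (\<Sum>z\<in>{z\<in>bits N. z ! j = b}. (cmod (\<psi> (z[j := b'])))\<^sup>2)"
    by (simp add: sum.inter_filter)
  also have "\<dots> = (\<Sum>w\<in>{w\<in>bits N. w ! j = b'}. (cmod (\<psi> w))\<^sup>2)"
    by (intro sum.reindex_bij_witness[of _ "\<lambda>z. z[j := b]" "\<lambda>z. z[j := b']"])
      (use assms in \<open>auto simp: bits_update_nth bits_update_same\<close>)
  finally show ?thesis .
qed

lemma contraction_unit_op:
  assumes "j < N"
  shows "contraction N (unit_op j b b')"
  unfolding contraction_def norm_sq_unit_op[OF assms]
  unfolding norm_sq_def
  by (intro allI sum_mono2) auto

text \<open>On the slice where qubit j has the value c, the operator is |c><b| Y |b'><c|, a product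
  of contractions. The two slices are orthogonal in input and output, so the squared norms add
  up.\<close>

lemma contraction_block_op:
  assumes Y: "contraction N Y" and j: "j < N"
  shows "contraction N (block_op j b b' Y)"
  unfolding contraction_def
proof
  fix \<psi>
  let ?C = "\<lambda>c. app N (unit_op j c b) (app N Y (app N (unit_op j b' c) \<psi>))"
  have split: "(\<Sum>z\<in>bits N. h z) = (\<Sum>c\<in>UNIV. \<Sum>z\<in>{z\<in>bits N. z ! j = c}. h z)" for h :: "_ \<Rightarrow> real"
    using sum.group[of "bits N" "UNIV :: bool set" "\<lambda>z. z ! j" h] by simp
  have eq: "app N (block_op j b b' Y) \<psi> z = ?C (z ! j) z" if z: "z \<in> bits N" for z
  proof -
    have "app N (block_op j b b' Y) \<psi> z =
        (\<Sum>w\<in>bits N. if w ! j = z ! j then Y (z[j := b]) (w[j := b']) * \<psi> w else 0)"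
      unfolding app_def block_op_def by (intro sum.cong) auto
    also have "\<dots> = (\<Sum>w\<in>{w\<in>bits N. w ! j = z ! j}. Y (z[j := b]) (w[j := b']) * \<psi> w)"
      by (simp add: sum.inter_filter)
    also have "\<dots> = (\<Sum>w\<in>{w\<in>bits N. w ! j = b'}. Y (z[j := b]) w * \<psi> (w[j := z ! j]))"
      by (intro sum.reindex_bij_witness[of _ "\<lambda>w. w[j := z ! j]" "\<lambda>w. w[j := b']"])
        (use j in \<open>auto simp: bits_update_nth bits_update_same\<close>)
    also have "\<dots> = (\<Sum>w\<in>bits N. if w ! j = b' then Y (z[j := b]) w * \<psi> (w[j := z ! j]) else 0)"
      by (simp add: sum.inter_filter)
    also have "\<dots> = app N Y (app N (unit_op j b' (z ! j)) \<psi>) (z[j := b])"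
      unfolding app_def[of N Y] by (intro sum.cong) (auto simp: app_unit_op)
    finally show ?thesis using z by (simp add: app_unit_op)
  qed
  have "norm_sq N (app N (block_op j b b' Y) \<psi>) =
      (\<Sum>c\<in>UNIV. \<Sum>z\<in>{z\<in>bits N. z ! j = c}. (cmod (?C c z))\<^sup>2)"
    unfolding norm_sq_def split by (intro sum.cong) (auto simp: eq)
  also have "\<dots> \<le> (\<Sum>c\<in>UNIV. norm_sq N (?C c))"
    unfolding norm_sq_def by (intro sum_mono sum_mono2) auto
  also have "\<dots> \<le> (\<Sum>c\<in>UNIV. norm_sq N (app N (unit_op j b' c) \<psi>))"
    using Y contraction_unit_op[OF j] unfolding contraction_def
    by (intro sum_mono) (meson order_trans)
  also have "\<dots> = norm_sq N \<psi>"
    by (simp add: norm_sq_unit_op[OF j] norm_sq_def[of N \<psi>] split[of "\<lambda>z. (cmod (\<psi> z))\<^sup>2"])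
  finally show "norm_sq N (app N (block_op j b b' Y) \<psi>) \<le> norm_sq N \<psi>" .
qed

text \<open>One qubit has four matrix units; this is the source of the factor 4 for every
  communicated qubit.\<close>

lemma block_decomposition:
  assumes "j < N" "z \<in> bits N" "w \<in> bits N"
  shows "Y z w = (\<Sum>(b, b')\<leftarrow>[(True, True), (True, False), (False, True), (False, False)].
    op_mult N (unit_op j b b') (block_op j b b' Y) z w)"
proof -
  have "z[j := z ! j] = z" "w[j := w ! j] = w" by auto
  then show ?thesis
    using assms by (cases "z ! j"; cases "w ! j") (auto simp: op_mult_unit_op block_op_def bits_update_nth)
qed

text \<open>The measure of complexity is the number c of product terms: each pairs an operator on
  \<open>S\<close> that knows only x with one on \<open>S'\<close> that knows only y, both of norm
  at most 1. A list counts repeated terms and keeps the count exact.\<close>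

definition decomposable ::
  "nat \<Rightarrow> nat \<Rightarrow> nat set \<Rightarrow> nat set \<Rightarrow> nat \<Rightarrow> (bool list \<Rightarrow> bool list \<Rightarrow> qop) \<Rightarrow> bool" where
  "decomposable N n S S' c E \<longleftrightarrow> (\<exists>L :: ((bool list \<Rightarrow> qop) \<times> (bool list \<Rightarrow> qop)) list.
     length L = c \<and>
     (\<forall>(X, Y)\<in>set L. \<forall>v. length v = n \<longrightarrow>
        contraction N (X v) \<and> acts_on N S (X v) \<and> contraction N (Y v) \<and> acts_on N S' (Y v)) \<and>
     (\<forall>x y. length x = n \<longrightarrow> length y = n \<longrightarrow> (\<forall>z\<in>bits N. \<forall>w\<in>bits N.
        E x y z w = (\<Sum>(X, Y)\<leftarrow>L. op_mult N (X x) (Y y) z w))))"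

text \<open>Factors on disjoint sets of qubits commute, so every pair can be reversed. This turns a
  round of Bob into a round of Alice with the roles exchanged.\<close>

lemma decomposable_swap:
  assumes "decomposable N n S S' c E" "S \<inter> S' = {}" "S \<subseteq> {0..<N}" "S' \<subseteq> {0..<N}"
  shows "decomposable N n S' S c (\<lambda>x y. E y x)"
proof -
  obtain L where L: "length L = c"
    "\<And>X Y v. (X, Y) \<in> set L \<Longrightarrow> length v = n \<Longrightarrow>
        contraction N (X v) \<and> acts_on N S (X v) \<and> contraction N (Y v) \<and> acts_on N S' (Y v)"
    "\<And>x y z w. length x = n \<Longrightarrow> length y = n \<Longrightarrow> z \<in> bits N \<Longrightarrow> w \<in> bits N \<Longrightarrow>
        E x y z w = (\<Sum>(X, Y)\<leftarrow>L. op_mult N (X x) (Y y) z w)"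
    using assms(1) unfolding decomposable_def by fast
  show ?thesis
    unfolding decomposable_def
  proof (intro exI[of _ "map prod.swap L"] conjI allI impI ballI)
    fix x y :: "bool list" and z w assume *: "length x = n" "length y = n" "z \<in> bits N" "w \<in> bits N"
    have "E y x z w = (\<Sum>(X, Y)\<leftarrow>L. op_mult N (X y) (Y x) z w)" by (rule L) (use * in auto)
    also have "\<dots> = (\<Sum>(X, Y)\<leftarrow>L. op_mult N (Y x) (X y) z w)"
      by (intro arg_cong[of _ _ sum_list] map_cong)
        (use L(2) * assms(2-4) in \<open>auto intro!: op_mult_commute[of N S _ S']\<close>)
    finally show "E y x z w = (\<Sum>(X, Y)\<leftarrow>map prod.swap L. op_mult N (X x) (Y y) z w)"
      by (simp add: comp_def case_prod_unfold)
  qed (use L in auto)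
qed

text \<open>Every second factor is expanded into its blocks at qubit j; the matrix unit, which acts
  on j alone, is merged into the first factor, and the block no longer touches j.\<close>

lemma decomposable_move_qubit:
  assumes "decomposable N n S S' c E" "j \<in> S'" "S \<subseteq> {0..<N}" "S' \<subseteq> {0..<N}"
  shows "decomposable N n (insert j S) (S' - {j}) (4 * c) E"
proof -
  obtain L where L: "length L = c"
    "\<And>X Y v. (X, Y) \<in> set L \<Longrightarrow> length v = n \<Longrightarrow>
        contraction N (X v) \<and> acts_on N S (X v) \<and> contraction N (Y v) \<and> acts_on N S' (Y v)"
    "\<And>x y z w. length x = n \<Longrightarrow> length y = n \<Longrightarrow> z \<in> bits N \<Longrightarrow> w \<in> bits N \<Longrightarrow>
        E x y z w = (\<Sum>(X, Y)\<leftarrow>L. op_mult N (X x) (Y y) z w)"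
    using assms(1) unfolding decomposable_def by fast
  have j: "j < N" using assms by auto
  define four where "four = [(True, True), (True, False), (False, True), (False, False)]"
  define split where "split = (\<lambda>(X, Y). map (\<lambda>(b, b').
    (\<lambda>x :: bool list. op_mult N (X x) (unit_op j b b'), \<lambda>y :: bool list. block_op j b b' (Y y))) four)"
  show ?thesis
    unfolding decomposable_def
  proof (intro exI[of _ "concat (map split L)"] conjI allI impI ballI)
    have "length (concat (map split M)) = 4 * length M" for M
      by (induction M) (auto simp: split_def four_def)
    then show "length (concat (map split L)) = 4 * c" using L by simp
  next
    fix XY assume "XY \<in> set (concat (map split L))"
    then obtain X Y b b' where XY: "(X, Y) \<in> set L"
      "XY = (\<lambda>x. op_mult N (X x) (unit_op j b b'), \<lambda>y. block_op j b b' (Y y))"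
      by (auto simp: split_def)
    have "acts_on N (insert j S) (op_mult N (X v) (unit_op j b b'))" if "acts_on N S (X v)" for v
      using that assms j
      by (intro acts_on_op_mult acts_on_mono[OF that] acts_on_mono[OF acts_on_unit_op[OF j]]) auto
    then show "case XY of (X, Y) \<Rightarrow> \<forall>v. length v = n \<longrightarrow>
        contraction N (X v) \<and> acts_on N (insert j S) (X v) \<and> contraction N (Y v) \<and> acts_on N (S' - {j}) (Y v)"
      using L(2)[OF XY(1)] assms j
      by (auto simp: XY(2) intro: contraction_op_mult contraction_unit_op contraction_block_op acts_on_block_op)
  next
    fix x y :: "bool list" and z w assume *: "length x = n" "length y = n" "z \<in> bits N" "w \<in> bits N"
    have split_eq: "op_mult N (X x) (Y y) z w = (\<Sum>(X, Y)\<leftarrow>split (X, Y). op_mult N (X x) (Y y) z w)" for X Y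
    proof -
      have "op_mult N (X x) (Y y) z w =
          (\<Sum>u\<in>bits N. X x z u * (\<Sum>(b, b')\<leftarrow>four. op_mult N (unit_op j b b') (block_op j b b' (Y y)) u w))"
        unfolding op_mult_def[of N "X x" "Y y"] four_def
        using * by (intro sum.cong refl arg_cong2[of _ _ _ _ "(*)"] block_decomposition j)
      also have "\<dots> = (\<Sum>(b, b')\<leftarrow>four. op_mult N (X x) (op_mult N (unit_op j b b') (block_op j b b' (Y y))) z w)"
        unfolding op_mult_def[of N "X x"] four_def by (simp add: distrib_left sum.distrib)
      finally show ?thesis by (simp add: split_def op_mult_assoc comp_def case_prod_unfold)
    qed
    have "(\<Sum>(X, Y)\<leftarrow>M. op_mult N (X x) (Y y) z w) =
        (\<Sum>(X, Y)\<leftarrow>concat (map split M). op_mult N (X x) (Y y) z w)" for M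
    proof (induction M)
      case (Cons XY M)
      obtain X Y where "XY = (X, Y)" by (cases XY)
      then show ?case using Cons.IH by (simp add: split_eq[of X Y, symmetric])
    qed simp
    then show "E x y z w = (\<Sum>(X, Y)\<leftarrow>concat (map split L). op_mult N (X x) (Y y) z w)"
      using L(3)[OF *] by simp
  qed
qed

lemma decomposable_move:
  assumes "decomposable N n S S' c E" "M \<subseteq> S'" "S \<subseteq> {0..<N}" "S' \<subseteq> {0..<N}"
  shows "decomposable N n (S \<union> M) (S' - M) (4 ^ card M * c) E"
proof -
  have "finite M" by (rule finite_subset[of _ "{0..<N}"]) (use assms in auto)
  then show ?thesis using assms(2)
  proof induction
    case (insert j M)
    have "decomposable N n (insert j (S \<union> M)) ((S' - M) - {j}) (4 * (4 ^ card M * c)) E"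
      using insert assms by (intro decomposable_move_qubit) auto
    moreover have "(S' - M) - {j} = S' - insert j M" by auto
    ultimately show ?case using insert by (simp add: mult.assoc)
  qed (use assms in simp)
qed

text \<open>\<open>U x\<close> acts on \<open>S\<close> and thus commutes with every second factor,
  so U* X Y U = (U* X U) Y: local unitaries are absorbed without new terms.\<close>

lemma decomposable_conjugate:
  assumes "decomposable N n S S' c E" "S \<inter> S' = {}" "S \<subseteq> {0..<N}" "S' \<subseteq> {0..<N}"
    and U: "\<And>v. length v = n \<Longrightarrow> unitary_op N (U v) \<and> acts_on N S (U v)"
  shows "decomposable N n S S' c (\<lambda>x y. op_mult N (adjoint (U x)) (op_mult N (E x y) (U x)))"
proof -
  obtain L where L: "length L = c"
    "\<And>X Y v. (X, Y) \<in> set L \<Longrightarrow> length v = n \<Longrightarrow>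
        contraction N (X v) \<and> acts_on N S (X v) \<and> contraction N (Y v) \<and> acts_on N S' (Y v)"
    "\<And>x y z w. length x = n \<Longrightarrow> length y = n \<Longrightarrow> z \<in> bits N \<Longrightarrow> w \<in> bits N \<Longrightarrow>
        E x y z w = (\<Sum>(X, Y)\<leftarrow>L. op_mult N (X x) (Y y) z w)"
    using assms(1) unfolding decomposable_def by fast
  let ?f = "\<lambda>(X, Y). (\<lambda>x. op_mult N (adjoint (U x)) (op_mult N (X x) (U x)), Y)"
  show ?thesis
    unfolding decomposable_def
  proof (intro exI[of _ "map ?f L"] conjI allI impI ballI)
    fix XY assume "XY \<in> set (map ?f L)"
    then obtain X Y where XY: "(X, Y) \<in> set L" "XY = ?f (X, Y)" by auto
    show "case XY of (X, Y) \<Rightarrow> \<forall>v. length v = n \<longrightarrow>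
        contraction N (X v) \<and> acts_on N S (X v) \<and> contraction N (Y v) \<and> acts_on N S' (Y v)"
      using L(2)[OF XY(1)] U contraction_unitary[of N "U _"] assms(3)
      by (auto simp: XY(2) intro!: contraction_op_mult contraction_adjoint acts_on_op_mult acts_on_adjoint)
  next
    fix x y :: "bool list" and z w assume *: "length x = n" "length y = n" "z \<in> bits N" "w \<in> bits N"
    have conj_eq: "op_mult N (adjoint (U x)) (op_mult N (op_mult N (X x) (Y y)) (U x)) z w =
        op_mult N (op_mult N (adjoint (U x)) (op_mult N (X x) (U x))) (Y y) z w" if "(X, Y) \<in> set L" for X Y
    proof -
      have YU: "op_mult N (Y y) (U x) z w = op_mult N (U x) (Y y) z w" if "z \<in> bits N" "w \<in> bits N" for z w
        using L(2)[OF \<open>(X, Y) \<in> set L\<close>] * assms(2-4) U that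
        by (intro op_mult_commute[of N S' _ S]) auto
      have XYU: "op_mult N (X x) (op_mult N (Y y) (U x)) z w = op_mult N (X x) (op_mult N (U x) (Y y)) z w"
        if "z \<in> bits N" "w \<in> bits N" for z w
        by (rule op_mult_cong) (use YU that in auto)
      show ?thesis unfolding op_mult_assoc by (rule op_mult_cong) (use XYU * in auto)
    qed
    have sums: "op_mult N A (op_mult N (\<lambda>z w. \<Sum>(X, Y)\<leftarrow>M. G X Y z w) B) z w =
       (\<Sum>(X, Y)\<leftarrow>M. op_mult N A (op_mult N (G X Y) B) z w)"
      for A B and M :: "((bool list \<Rightarrow> qop) \<times> (bool list \<Rightarrow> qop)) list" and G
    proof (induction M)
      case (Cons XY M)
      then show ?case
        by (cases XY) (auto simp: op_mult_def sum.distrib distrib_left distrib_right)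
    qed (simp add: op_mult_def)
    have "op_mult N (adjoint (U x)) (op_mult N (E x y) (U x)) z w =
        op_mult N (adjoint (U x)) (op_mult N (\<lambda>z w. \<Sum>(X, Y)\<leftarrow>L. op_mult N (X x) (Y y) z w) (U x)) z w"
      using * L(3) by (intro op_mult_cong) auto
    also have "\<dots> = (\<Sum>(X, Y)\<leftarrow>L. op_mult N (op_mult N (adjoint (U x)) (op_mult N (X x) (U x))) (Y y) z w)"
      unfolding sums by (intro arg_cong[of _ _ sum_list] map_cong refl) (auto simp: conj_eq)
    finally show "op_mult N (adjoint (U x)) (op_mult N (E x y) (U x)) z w =
        (\<Sum>(X, Y)\<leftarrow>map ?f L. op_mult N (X x) (Y y) z w)"
      by (simp add: comp_def case_prod_unfold)
  qed (use L in auto)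
qed

fun heisenberg :: "nat \<Rightarrow> nat \<Rightarrow> round list \<Rightarrow> bool list \<Rightarrow> bool list \<Rightarrow> qop" where
  "heisenberg N q [] x y = (\<lambda>z w. if z = w \<and> z ! q then 1 else 0)"
| "heisenberg N q ((s, U, M) # rs) x y =
    (let V = U (if s then x else y) in op_mult N (adjoint V) (op_mult N (heisenberg N q rs x y) V))"

text \<open>The first round is the outermost conjugation, matching the order in which
  \<open>run\<close> applies the unitaries, so an induction step only moves one unitary across the
  inner product.\<close>

lemma prob_one_heisenberg:
  "complex_of_real (prob_one N q (run N x y rs \<psi>)) = inner N \<psi> (app N (heisenberg N q rs x y) \<psi>)"
proof (induction rs arbitrary: \<psi>)
  case Nil
  have app: "app N (heisenberg N q [] x y) \<psi> z = (if z ! q then \<psi> z else 0)" if "z \<in> bits N" for z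
  proof -
    have "app N (heisenberg N q [] x y) \<psi> z = (\<Sum>w\<in>bits N. if w = z then (if z ! q then \<psi> z else 0) else 0)"
      unfolding app_def by (intro sum.cong) auto
    then show ?thesis using that by simp
  qed
  have "inner N \<psi> (app N (heisenberg N q [] x y) \<psi>) = (\<Sum>z\<in>bits N. if z ! q then complex_of_real ((cmod (\<psi> z))\<^sup>2) else 0)"
    unfolding inner_def by (intro sum.cong) (auto simp: app complex_norm_square mult.commute simp del: of_real_power heisenberg.simps)
  also have "\<dots> = complex_of_real (prob_one N q \<psi>)"
    unfolding prob_one_def sum.inter_filter[OF finite_bits] of_real_sum by (intro sum.cong) auto
  finally show ?case by simp
next
  case (Cons r rs)
  obtain s U M where r: "r = (s, U, M)" by (cases r)
  show ?case unfolding r by (simp add: Cons.IH Let_def app_op_mult inner_app)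
qed

lemma acts_on_id_op: "acts_on N S id_op" if "S \<subseteq> {0..<N}"
  unfolding acts_on_def id_op_def
proof (intro conjI ballI impI)
  fix z w z' w' assume b: "z \<in> bits N" "w \<in> bits N" "z' \<in> bits N" "w' \<in> bits N"
    and ag: "agree_on S z z' \<and> agree_on S w w' \<and> agree_on ({0..<N} - S) z w \<and> agree_on ({0..<N} - S) z' w'"
  have eq: "u = v \<longleftrightarrow> agree_on S u v" if "u \<in> bits N" "v \<in> bits N" "agree_on ({0..<N} - S) u v" for u v
    using that by (auto simp: agree_on_def intro!: bits_eqI[of _ N])
  show "(if z = w then 1 else 0) = (if z' = w' then 1 else (0 :: complex))"
    using ag eq[OF b(1,2)] eq[OF b(3,4)] by (auto simp: agree_on_def)
qed (auto simp: agree_on_def)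

text \<open>Bob's readout is the identity times |1><1| on qubit q: a single term, from which the
  count starts.\<close>

lemma decomposable_measurement:
  assumes "q \<in> S'" "S \<subseteq> {0..<N}" "S' \<subseteq> {0..<N}"
  shows "decomposable N n S S' 1 (heisenberg N q [])"
proof -
  let ?P = "unit_op q True True"
  have "op_mult N id_op ?P z w = heisenberg N q [] x y z w" if "z \<in> bits N" "w \<in> bits N" for z w x y
  proof -
    have "op_mult N id_op ?P z w = ?P z w"
      using that by (simp add: op_mult_def id_op_def if_distrib[of "\<lambda>a. a * _"] cong: if_cong)
    moreover have "z[q := True] = z" if "z ! q" using that by (metis list_update_id)
    ultimately show ?thesis by (auto simp: unit_op_def)
  qed
  moreover have "acts_on N S' ?P" using acts_on_mono[OF acts_on_unit_op[of q N True True], of S'] assms by auto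
  ultimately show ?thesis
    unfolding decomposable_def using assms
    by (intro exI[of _ "[(\<lambda>_. id_op, \<lambda>_. ?P)]"])
      (auto simp: contraction_id_op acts_on_id_op contraction_unit_op)
qed

text \<open>The operator is followed backwards in time, so a round is undone: the qubits
  \<open>M\<close> return from the receiver to the sender at the price of a factor 4^(card M), and
  then the sender's unitary, which may act on \<open>M\<close> as well, is absorbed.\<close>

lemma decomposable_heisenberg:
  assumes "valid_rounds N n A rs" "A \<subseteq> {0..<N}" "q < N" "q \<notin> ownA A rs"
  shows "decomposable N n A ({0..<N} - A) (4 ^ cost rs) (heisenberg N q rs)"
  using assms
proof (induction rs arbitrary: A)
  case Nil
  then show ?case using decomposable_measurement[of q "{0..<N} - A" A N n] by (simp add: cost_def del: heisenberg.simps)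
next
  case (Cons r rs)
  obtain s U M where r: "r = (s, U, M)" by (cases r)
  define S where "S = (if s then A else {0..<N} - A)"
  define A' where "A' = (if s then A - M else A \<union> M)"
  have v: "M \<subseteq> S" "\<And>v. length v = n \<Longrightarrow> unitary_op N (U v) \<and> acts_on N S (U v)" "valid_rounds N n A' rs"
    using Cons.prems(1) by (auto simp: r S_def A'_def Let_def)
  have A': "A' \<subseteq> {0..<N}" "q \<notin> ownA A' rs"
    using v(1) Cons.prems by (auto simp: A'_def S_def r split: if_splits)
  note IH = Cons.IH[OF v(3) A'(1) Cons.prems(3) A'(2)]
  have cost: "cost (r # rs) = card M + cost rs" by (simp add: cost_def r)
  show ?case
  proof (cases s)
    case True
    have "decomposable N n (A' \<union> M) ({0..<N} - A' - M) (4 ^ card M * 4 ^ cost rs) (heisenberg N q rs)"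
      by (rule decomposable_move[OF IH]) (use True v(1) A' Cons.prems in \<open>auto simp: S_def A'_def\<close>)
    moreover have "A' \<union> M = A" "{0..<N} - A' - M = {0..<N} - A"
      using True v(1) by (auto simp: A'_def S_def)
    ultimately have "decomposable N n A ({0..<N} - A) (4 ^ cost (r # rs)) (heisenberg N q rs)"
      by (simp add: cost power_add)
    then have "decomposable N n A ({0..<N} - A) (4 ^ cost (r # rs))
        (\<lambda>x y. op_mult N (adjoint (U x)) (op_mult N (heisenberg N q rs x y) (U x)))"
      by (rule decomposable_conjugate) (use True v(2) Cons.prems in \<open>auto simp: S_def\<close>)
    moreover have "heisenberg N q (r # rs) =
       (\<lambda>x y. op_mult N (adjoint (U x)) (op_mult N (heisenberg N q rs x y) (U x)))"
      by (intro ext) (simp add: r True Let_def)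
    ultimately show ?thesis by simp
  next
    case False
    \<comment> \<open>Bob is the sender here, so the first slot has to be his: the roles are
      exchanged, the same two steps are made, and the roles are exchanged back.\<close>
    have "decomposable N n ({0..<N} - A') A' (4 ^ cost rs) (\<lambda>x y. heisenberg N q rs y x)"
      by (rule decomposable_swap[OF IH]) (use A' in auto)
    then have "decomposable N n ({0..<N} - A' \<union> M) (A' - M) (4 ^ card M * 4 ^ cost rs) (\<lambda>x y. heisenberg N q rs y x)"
      by (rule decomposable_move) (use False v(1) A' in \<open>auto simp: S_def A'_def\<close>)
    moreover have "{0..<N} - A' \<union> M = {0..<N} - A" "A' - M = A"
      using False v(1) Cons.prems(2) by (auto simp: A'_def S_def)
    ultimately have "decomposable N n ({0..<N} - A) A (4 ^ cost (r # rs)) (\<lambda>x y. heisenberg N q rs y x)"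
      by (simp add: cost power_add)
    then have "decomposable N n ({0..<N} - A) A (4 ^ cost (r # rs))
        (\<lambda>x y. op_mult N (adjoint (U x)) (op_mult N (heisenberg N q rs y x) (U x)))"
      by (rule decomposable_conjugate) (use False v(2) Cons.prems in \<open>auto simp: S_def\<close>)
    from decomposable_swap[OF this] Cons.prems(2)
    have "decomposable N n A ({0..<N} - A) (4 ^ cost (r # rs))
        (\<lambda>x y. op_mult N (adjoint (U y)) (op_mult N (heisenberg N q rs x y) (U y)))" by auto
    moreover have "heisenberg N q (r # rs) =
       (\<lambda>x y. op_mult N (adjoint (U y)) (op_mult N (heisenberg N q rs x y) (U y)))"
      by (intro ext) (simp add: r False Let_def)
    ultimately show ?thesis by simp
  qed
qed

text \<open><\<psi>0, X Y \<psi>0> = <X* \<psi>0, Y \<psi>0> separates the two inputs. Concatenating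
  4^k terms gives vectors of squared norm at most 4^k; dividing each by 2^k normalises them and
  scales their inner product by 4^-k. The dimension still depends on the shared state.\<close>

lemma ent_protocol_factorization:
  assumes ent: "ent_computes n f N A \<psi>0 rs q"
  obtains J :: "(nat \<times> bool list \<times> bool) set" and a b
  where "finite J"
    and "\<And>x. length x = n \<Longrightarrow> (\<Sum>j\<in>J. (a x j)\<^sup>2) \<le> (1 :: real)"
    and "\<And>y. length y = n \<Longrightarrow> (\<Sum>j\<in>J. (b y j)\<^sup>2) \<le> (1 :: real)"
    and "\<And>x y. length x = n \<Longrightarrow> length y = n \<Longrightarrow>
      (\<Sum>j\<in>J. a x j * b y j) = prob_one N q (run N x y rs \<psi>0) / 4 ^ cost rs"
proof -
  have ent': "A \<subseteq> {0..<N}" "norm_sq N \<psi>0 = 1" "valid_rounds N n A rs" "q < N" "q \<notin> ownA A rs"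
    using ent by (auto simp: ent_computes_def unit_vec_def norm_sq_def)
  define k where "k = cost rs"
  obtain L where L: "length L = 4 ^ k"
    "\<And>X Y v. (X, Y) \<in> set L \<Longrightarrow> length v = n \<Longrightarrow>
        contraction N (X v) \<and> acts_on N A (X v) \<and> contraction N (Y v) \<and> acts_on N ({0..<N} - A) (Y v)"
    "\<And>x y z w. length x = n \<Longrightarrow> length y = n \<Longrightarrow> z \<in> bits N \<Longrightarrow> w \<in> bits N \<Longrightarrow>
        heisenberg N q rs x y z w = (\<Sum>(X, Y)\<leftarrow>L. op_mult N (X x) (Y y) z w)"
    using decomposable_heisenberg[OF ent'(3,1,4,5)] unfolding decomposable_def k_def by fast
  \<comment> \<open>Coordinates are labelled by term, basis string, and real or imaginary part. The
    inner product of these real vectors is the real part of the complex one, which suffices because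
    a probability is real.\<close>
  define J where "J = {..<length L} \<times> bits N \<times> (UNIV :: bool set)"
  define part :: "bool \<Rightarrow> complex \<Rightarrow> real" where "part = (\<lambda>c u. if c then Re u else Im u)"
  define \<alpha> where "\<alpha> = (\<lambda>x i. app N (adjoint (fst (L ! i) x)) \<psi>0)"
  define \<beta> where "\<beta> = (\<lambda>y i. app N (snd (L ! i) y) \<psi>0)"
  define a where "a = (\<lambda>x (i, z, c). part c (\<alpha> x i z) / 2 ^ k)"
  define b where "b = (\<lambda>y (i, z, c). part c (\<beta> y i z) / 2 ^ k)"
  have sumJ: "(\<Sum>j\<in>J. g j) = (\<Sum>i<length L. \<Sum>z\<in>bits N. g (i, z, True) + g (i, z, False))" for g :: "_ \<Rightarrow> real"
    unfolding J_def by (simp add: sum.cartesian_product' UNIV_bool add.commute)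
  have four: "(4 :: real) ^ k = 2 ^ k * 2 ^ k" by (simp add: power_mult_distrib[symmetric])
  have len: "(\<Sum>i<length L. h i / 4 ^ k) \<le> 1" if "\<And>i. i < length L \<Longrightarrow> h i \<le> 1" for h :: "nat \<Rightarrow> real"
  proof -
    have "(\<Sum>i<length L. h i / 4 ^ k) \<le> (\<Sum>i<length L. 1 / 4 ^ k)"
      using that by (intro sum_mono divide_right_mono) auto
    also have "\<dots> = 1" by (simp add: L(1))
    finally show ?thesis .
  qed
  show thesis
  proof (rule that[of J a b])
    show "finite J" by (simp add: J_def)
  next
    fix x :: "bool list" assume x: "length x = n"
    have "(\<Sum>j\<in>J. (a x j)\<^sup>2) = (\<Sum>i<length L. norm_sq N (\<alpha> x i) / 4 ^ k)"
      unfolding sumJ by (simp add: a_def part_def norm_sq_def cmod_power2 power_divide four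
          power2_eq_square[of "2 ^ k"] sum_divide_distrib add_divide_distrib)
    also have "\<dots> \<le> 1"
    proof (rule len)
      fix i assume i: "i < length L"
      then have "contraction N (adjoint (fst (L ! i) x))"
        using L(2)[of "fst (L ! i)" "snd (L ! i)" x] x by (auto intro: contraction_adjoint)
      then show "norm_sq N (\<alpha> x i) \<le> 1" using ent'(2) by (metis \<alpha>_def contraction_def)
    qed
    finally show "(\<Sum>j\<in>J. (a x j)\<^sup>2) \<le> 1" .
  next
    fix y :: "bool list" assume y: "length y = n"
    have "(\<Sum>j\<in>J. (b y j)\<^sup>2) = (\<Sum>i<length L. norm_sq N (\<beta> y i) / 4 ^ k)"
      unfolding sumJ by (simp add: b_def part_def norm_sq_def cmod_power2 power_divide four
          power2_eq_square[of "2 ^ k"] sum_divide_distrib add_divide_distrib)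
    also have "\<dots> \<le> 1"
    proof (rule len)
      fix i assume i: "i < length L"
      then have "contraction N (snd (L ! i) y)"
        using L(2)[of "fst (L ! i)" "snd (L ! i)" y] y by auto
      then show "norm_sq N (\<beta> y i) \<le> 1" using ent'(2) by (metis \<beta>_def contraction_def)
    qed
    finally show "(\<Sum>j\<in>J. (b y j)\<^sup>2) \<le> 1" .
  next
    fix x y :: "bool list" assume x: "length x = n" and y: "length y = n"
    have "complex_of_real (prob_one N q (run N x y rs \<psi>0)) =
        inner N \<psi>0 (app N (heisenberg N q rs x y) \<psi>0)"
      by (rule prob_one_heisenberg)
    also have "\<dots> = inner N \<psi>0 (app N (\<lambda>z w. \<Sum>i<length L. op_mult N (fst (L ! i) x) (snd (L ! i) y) z w) \<psi>0)"
      unfolding inner_def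
      by (intro sum.cong refl arg_cong2[of _ _ _ _ "(*)"] app_cong)
        (auto simp: L(3)[OF x y] sum_list_sum_nth case_prod_unfold atLeast0LessThan intro!: sum.cong)
    also have "\<dots> = (\<Sum>i<length L. inner N \<psi>0 (app N (op_mult N (fst (L ! i) x) (snd (L ! i) y)) \<psi>0))"
    proof -
      have "app N (\<lambda>z w. \<Sum>i<length L. G i z w) \<psi>0 = (\<lambda>z. \<Sum>i<length L. app N (G i) \<psi>0 z)" for G
        unfolding app_def by (simp add: sum_distrib_right) (subst sum.swap, simp)
      moreover have "inner N \<psi>0 (\<lambda>z. \<Sum>i<length L. g i z) = (\<Sum>i<length L. inner N \<psi>0 (g i))" for g
        unfolding inner_def by (simp add: sum_distrib_left) (rule sum.swap)
      ultimately show ?thesis by simp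
    qed
    also have "\<dots> = (\<Sum>i<length L. inner N (\<alpha> x i) (\<beta> y i))"
      by (simp add: app_op_mult \<alpha>_def \<beta>_def inner_app)
    finally have "prob_one N q (run N x y rs \<psi>0) = Re (\<Sum>i<length L. inner N (\<alpha> x i) (\<beta> y i))"
      by (metis Re_complex_of_real)
    also have "\<dots> = (\<Sum>i<length L. \<Sum>z\<in>bits N. Re (\<alpha> x i z) * Re (\<beta> y i z) + Im (\<alpha> x i z) * Im (\<beta> y i z))"
      by (simp add: inner_def)
    finally show "(\<Sum>j\<in>J. a x j * b y j) = prob_one N q (run N x y rs \<psi>0) / 4 ^ cost rs"
      unfolding sumJ k_def[symmetric]
      by (simp add: a_def b_def part_def four sum_divide_distrib add_divide_distrib)
  qed
qed

section \<open>Implementing projective measurements as protocols\<close>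

definition same_outside :: "nat \<Rightarrow> nat \<Rightarrow> bool list \<Rightarrow> bool list \<Rightarrow> bool" where
  "same_outside p L z w \<longleftrightarrow> take p z = take p w \<and> drop (p + L) z = drop (p + L) w"

definition segment :: "nat \<Rightarrow> nat \<Rightarrow> bool list \<Rightarrow> bool list" where
  "segment p L z = take L (drop p z)"

definition splice_at :: "nat \<Rightarrow> nat \<Rightarrow> bool list \<Rightarrow> bool list \<Rightarrow> bool list" where
  "splice_at p L z m = take p z @ m @ drop (p + L) z"

text \<open>\<open>W\<close> on the \<open>L\<close> qubits from position \<open>p\<close>, tensored
  with the identity. Phrased with \<open>take\<close> and \<open>drop\<close>, it reduces sums over
  long strings to sums over the middle \<open>L\<close> bits;
  \<open>same_outside_iff_agree_on\<close> translates back to the language of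
  \<open>acts_on\<close>.\<close>

definition lift_op :: "nat \<Rightarrow> nat \<Rightarrow> qop \<Rightarrow> qop" where
  "lift_op p L W = (\<lambda>z w. if same_outside p L z w then W (segment p L z) (segment p L w) else 0)"

lemma segment_bits [simp]: "p + L \<le> N \<Longrightarrow> z \<in> bits N \<Longrightarrow> segment p L z \<in> bits L"
  by (simp add: segment_def bits_def)

lemma splice_at_bits [simp]: "p + L \<le> N \<Longrightarrow> z \<in> bits N \<Longrightarrow> m \<in> bits L \<Longrightarrow> splice_at p L z m \<in> bits N"
  by (simp add: splice_at_def bits_def)

lemma segment_splice_at [simp]:
  "p + L \<le> N \<Longrightarrow> z \<in> bits N \<Longrightarrow> m \<in> bits L \<Longrightarrow> segment p L (splice_at p L z m) = m"
  by (simp add: splice_at_def segment_def bits_def)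

lemma same_outside_splice_at [simp]:
  "p + L \<le> N \<Longrightarrow> z \<in> bits N \<Longrightarrow> m \<in> bits L \<Longrightarrow> same_outside p L (splice_at p L z m) w \<longleftrightarrow> same_outside p L z w"
  by (simp add: splice_at_def same_outside_def bits_def)

lemma same_outside_sym: "same_outside p L z w \<longleftrightarrow> same_outside p L w z"
  by (auto simp: same_outside_def)

lemma same_outside_refl [simp]: "same_outside p L z z"
  by (simp add: same_outside_def)

lemma split_segment: "z = take p z @ segment p L z @ drop (p + L) z"
  using append_take_drop_id[of p z] append_take_drop_id[of L "drop p z"]
  by (simp add: segment_def add.commute)

lemma splice_at_segment: "same_outside p L z u \<Longrightarrow> splice_at p L z (segment p L u) = u"
  using split_segment[of u p L] by (simp add: splice_at_def same_outside_def)

lemma sum_same_outside: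
  assumes "p + L \<le> N" "z \<in> bits N"
  shows "(\<Sum>u\<in>bits N. if same_outside p L z u then h u else 0) = (\<Sum>m\<in>bits L. h (splice_at p L z m))"
proof -
  have "(\<Sum>u\<in>bits N. if same_outside p L z u then h u else 0) = (\<Sum>u\<in>{u\<in>bits N. same_outside p L z u}. h u)"
    by (simp add: sum.inter_filter)
  also have "\<dots> = (\<Sum>m\<in>bits L. h (splice_at p L z m))"
    using assms same_outside_splice_at[OF assms, of _ z]
    by (intro sum.reindex_bij_witness[of _ "splice_at p L z" "segment p L"])
      (auto simp: splice_at_segment same_outside_sym[of p L z])
  finally show ?thesis .
qed

lemma app_lift_op:
  assumes "p + L \<le> N" "z \<in> bits N"
  shows "app N (lift_op p L W) \<psi> z = (\<Sum>m\<in>bits L. W (segment p L z) m * \<psi> (splice_at p L z m))"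
proof -
  have "app N (lift_op p L W) \<psi> z =
      (\<Sum>u\<in>bits N. if same_outside p L z u then W (segment p L z) (segment p L u) * \<psi> u else 0)"
    unfolding app_def lift_op_def by (intro sum.cong) auto
  then show ?thesis unfolding sum_same_outside[OF assms] using assms by (simp cong: sum.cong)
qed

lemma unitary_lift_op:
  assumes W: "unitary_op L W" and p: "p + L \<le> N"
  shows "unitary_op N (lift_op p L W)"
  unfolding unitary_op_def
proof (intro ballI)
  fix z w assume z: "z \<in> bits N" and w: "w \<in> bits N"
  have "(\<Sum>u\<in>bits N. cnj (lift_op p L W u z) * lift_op p L W u w) =
      (\<Sum>u\<in>bits N. if same_outside p L z u then
        cnj (W (segment p L u) (segment p L z)) * (if same_outside p L u w then W (segment p L u) (segment p L w) else 0) else 0)"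
    unfolding lift_op_def by (intro sum.cong) (auto simp: same_outside_sym)
  also have "\<dots> = (\<Sum>m\<in>bits L. cnj (W m (segment p L z)) * (if same_outside p L z w then W m (segment p L w) else 0))"
    unfolding sum_same_outside[OF p z] using p z by (intro sum.cong) auto
  also have "\<dots> = (if same_outside p L z w then if segment p L z = segment p L w then 1 else 0 else 0)"
    using W p z w by (simp add: unitary_op_def)
  also have "\<dots> = (if z = w then 1 else 0)"
    using splice_at_segment[of p L z w] splice_at_segment[of p L z z] by auto
  finally show "(\<Sum>u\<in>bits N. cnj (lift_op p L W u z) * lift_op p L W u w) = (if z = w then 1 else 0)" .
qed

lemma same_outside_iff_agree_on:
  assumes "p + L \<le> N" "z \<in> bits N" "w \<in> bits N"
  shows "same_outside p L z w \<longleftrightarrow> agree_on ({0..<N} - {p..<p + L}) z w"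
proof
  assume s: "same_outside p L z w"
  show "agree_on ({0..<N} - {p..<p + L}) z w"
    unfolding agree_on_def
  proof
    fix i assume i: "i \<in> {0..<N} - {p..<p + L}"
    show "z ! i = w ! i"
    proof (cases "i < p")
      case True
      then show ?thesis using s by (metis nth_take same_outside_def)
    next
      case False
      then have "i = (p + L) + (i - (p + L))" using i by auto
      moreover have "drop (p + L) z ! (i - (p + L)) = drop (p + L) w ! (i - (p + L))"
        using s by (simp add: same_outside_def)
      ultimately show ?thesis using assms by (simp add: bits_def)
    qed
  qed
next
  assume "agree_on ({0..<N} - {p..<p + L}) z w"
  then show "same_outside p L z w"
    using assms unfolding same_outside_def agree_on_def bits_def
    by (auto intro!: nth_equalityI)
qed

lemma segment_eqI:
  assumes "p + L \<le> N" "z \<in> bits N" "w \<in> bits N" "agree_on {p..<p + L} z w"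
  shows "segment p L z = segment p L w"
  using assms unfolding segment_def agree_on_def bits_def by (auto intro!: nth_equalityI)

lemma acts_on_lift_op:
  assumes "p + L \<le> N"
  shows "acts_on N {p..<p + L} (lift_op p L W)"
  unfolding acts_on_def lift_op_def
  using same_outside_iff_agree_on[OF assms] segment_eqI[OF assms] by (auto cong: if_cong)

lemma acts_on_everything: "acts_on N {0..<N} U"
proof -
  have "z = w" if "z \<in> bits N" "w \<in> bits N" "agree_on {0..<N} z w" for z w
    using that by (intro bits_eqI[of _ N]) (auto simp: agree_on_def)
  then show ?thesis unfolding acts_on_def by (metis Diff_cancel agree_on_def empty_iff)
qed

text \<open>A Householder reflection: 1 - c h h^T with h = e_0 - \<alpha> exchanges the unit vectors
  e_0 and \<alpha>, so its column at the all-zero string is \<alpha>.\<close>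

lemma exists_unitary_first_column:
  fixes \<alpha> :: "bool list \<Rightarrow> real"
  assumes \<alpha>: "(\<Sum>z\<in>bits L. (\<alpha> z)\<^sup>2) = 1"
  shows "\<exists>W. unitary_op L W \<and> (\<forall>z\<in>bits L. W z (replicate L False) = complex_of_real (\<alpha> z))"
proof -
  define o0 where "o0 = replicate L False"
  have o0: "o0 \<in> bits L" by (simp add: o0_def bits_def)
  define \<delta> :: "bool list \<Rightarrow> bool list \<Rightarrow> real" where "\<delta> = (\<lambda>z w. if z = w then 1 else 0)"
  define h where "h = (\<lambda>z. \<delta> z o0 - \<alpha> z)"
  \<comment> \<open>c is 2 / |h|^2, where |h|^2 = 2 (1 - \<alpha> o0). If \<alpha> o0 = 1 then h =
    0, and the value c = 0 makes W the identity.\<close>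
  define c where "c = (if \<alpha> o0 = 1 then 0 else 1 / (1 - \<alpha> o0))"
  define W where "W = (\<lambda>z w. \<delta> z w - c * h z * h w)"
  have sum_\<delta>: "(\<Sum>u\<in>bits L. \<delta> u z * g u) = g z" "(\<Sum>u\<in>bits L. g u * \<delta> u z) = g z"
    if "z \<in> bits L" for z g
    using that by (simp_all add: \<delta>_def if_distrib[of "\<lambda>a. a * _"] if_distrib[of "\<lambda>a. _ * a"] cong: if_cong)
  have "(\<Sum>u\<in>bits L. (h u)\<^sup>2) = (\<Sum>u\<in>bits L. \<delta> u o0 * \<delta> u o0 - 2 * (\<delta> u o0 * \<alpha> u) + (\<alpha> u)\<^sup>2)"
    by (intro sum.cong) (auto simp: h_def power2_eq_square algebra_simps)
  also have "\<dots> = \<delta> o0 o0 - 2 * \<alpha> o0 + 1"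
    using o0 \<alpha> by (simp add: sum.distrib sum_subtractf sum_distrib_left[symmetric] sum_\<delta>)
  finally have h2: "(\<Sum>u\<in>bits L. (h u)\<^sup>2) = 2 * (1 - \<alpha> o0)" by (simp add: \<delta>_def)
  have c: "c * (1 - \<alpha> o0) * h z = h z" if "z \<in> bits L" for z
  proof (cases "\<alpha> o0 = 1")
    case True
    then have "(h z)\<^sup>2 \<le> 0" using h2 that member_le_sum[of z "bits L" "\<lambda>u. (h u)\<^sup>2"] by simp
    then show ?thesis by simp
  qed (simp add: c_def)
  have "unitary_op L (\<lambda>z w. complex_of_real (W z w))"
    unfolding unitary_op_def
  proof (intro ballI)
    fix z w assume z: "z \<in> bits L" and w: "w \<in> bits L"
    have "(\<Sum>u\<in>bits L. W u z * W u w) =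
       (\<Sum>u\<in>bits L. \<delta> u z * \<delta> u w - c * h w * (\<delta> u z * h u) - c * h z * (\<delta> u w * h u) + c * h z * (c * h w) * (h u)\<^sup>2)"
      unfolding W_def by (intro sum.cong) (auto simp: power2_eq_square algebra_simps)
    also have "\<dots> = \<delta> z w - c * h w * h z - c * h z * h w + c * h z * (c * h w) * (2 * (1 - \<alpha> o0))"
      using z w by (simp add: sum.distrib sum_subtractf sum_distrib_left[symmetric] sum_\<delta> h2)
    also have "\<dots> = \<delta> z w - 2 * c * h z * (h w - c * (1 - \<alpha> o0) * h w)"
      by (simp add: algebra_simps)
    also have "\<dots> = \<delta> z w" by (simp add: c[OF w])
    finally have "complex_of_real (\<Sum>u\<in>bits L. W u z * W u w) = complex_of_real (\<delta> z w)" by simp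
    then show "(\<Sum>u\<in>bits L. cnj (complex_of_real (W u z)) * complex_of_real (W u w)) = (if z = w then 1 else 0)"
      by (simp add: \<delta>_def)
  qed
  moreover have "W z o0 = \<alpha> z" if "z \<in> bits L" for z
  proof -
    have "W z o0 = \<delta> z o0 - c * (1 - \<alpha> o0) * h z" by (simp add: W_def h_def[of] \<delta>_def)
    then show ?thesis unfolding c[OF that] by (simp add: h_def)
  qed
  ultimately show ?thesis unfolding o0_def by (intro exI[of _ "\<lambda>z w. complex_of_real (W z w)"]) auto
qed

section \<open>Measurements with an outcome qubit\<close>

definition projector :: "nat \<Rightarrow> qop \<Rightarrow> bool" where
  "projector M P \<longleftrightarrow> (\<forall>z\<in>bits M. \<forall>w\<in>bits M. cnj (P w z) = P z w \<and> op_mult M P P z w = P z w)"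

text \<open>The projective measurement \<open>{1 - P, P}\<close> with its outcome written to an extra last qubit:
  \<open>P \<otimes> X + (1 - P) \<otimes> 1\<close>.\<close>
definition measure_op :: "nat \<Rightarrow> qop \<Rightarrow> qop" where
  "measure_op M P = (\<lambda>z w. if z ! M = w ! M then id_op (take M z) (take M w) - P (take M z) (take M w)
     else P (take M z) (take M w))"

lemma sum_bits_Suc: "(\<Sum>z\<in>bits (Suc M). g z) = (\<Sum>z\<in>bits M. g (z @ [False]) + g (z @ [True]))"
proof -
  have "bits (Suc M) = (\<lambda>z. z @ [False]) ` bits M \<union> (\<lambda>z. z @ [True]) ` bits M"
  proof (intro equalityI subsetI)
    fix z :: "bool list" assume "z \<in> bits (Suc M)"
    then have "z \<noteq> []" "butlast z \<in> bits M" by (auto simp: bits_def)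
    then have "z = butlast z @ [last z]" "butlast z \<in> bits M" by simp_all
    then show "z \<in> (\<lambda>z. z @ [False]) ` bits M \<union> (\<lambda>z. z @ [True]) ` bits M"
      by (cases "last z") auto
  qed (auto simp: bits_def)
  then have "(\<Sum>z\<in>bits (Suc M). g z) =
      sum g ((\<lambda>z. z @ [False]) ` bits M) + sum g ((\<lambda>z. z @ [True]) ` bits M)"
    by (simp only:) (rule sum.union_disjoint; auto)
  then show ?thesis by (simp add: sum.reindex inj_on_def sum.distrib)
qed

lemma bits_Suc_cases:
  assumes "z \<in> bits (Suc M)"
  obtains z' b where "z' \<in> bits M" "z = z' @ [b]"
proof
  show "butlast z \<in> bits M" using assms by (auto simp: bits_def)
  have "z \<noteq> []" using assms by (auto simp: bits_def)
  then show "z = butlast z @ [last z]" by simp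
qed

lemma measure_op_append:
  assumes "z \<in> bits M" "w \<in> bits M"
  shows "measure_op M P (z @ [b]) (w @ [c]) = (if b = c then id_op z w - P z w else P z w)"
  using assms by (auto simp: measure_op_def bits_def nth_append)

text \<open>Equal last bits give (1 - P)^2 + P^2 = 1 and different ones (1 - P) P + P (1 - P) = 0,
  because P is a projection.\<close>

lemma unitary_measure_op:
  assumes P: "projector M P"
  shows "unitary_op (Suc M) (measure_op M P)"
  unfolding unitary_op_def
proof (intro ballI)
  fix z w assume "z \<in> bits (Suc M)" "w \<in> bits (Suc M)"
  then obtain z' b w' c where z: "z' \<in> bits M" "z = z' @ [b]" and w: "w' \<in> bits M" "w = w' @ [c]"
    by (metis bits_Suc_cases)
  have PP: "(\<Sum>u\<in>bits M. P z' u * P u w') = P z' w'"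
    using P z(1) w(1) by (simp add: projector_def op_mult_def)
  have sum_id: "(\<Sum>u\<in>bits M. id_op u z' * g u) = g z'" "(\<Sum>u\<in>bits M. g u * id_op u w') = g w'" for g
    using z(1) w(1) by (simp_all add: id_op_def if_distrib[of "\<lambda>a. a * _"] if_distrib[of "\<lambda>a. _ * a"] cong: if_cong)
  have cid: "cnj (id_op u v) = id_op u v" for u v by (simp add: id_op_def)
  have cP: "cnj (P u z') = P z' u" if "u \<in> bits M" for u
    using P z(1) that by (simp add: projector_def)
  have "(\<Sum>u\<in>bits M. P z' u * (id_op u w' - P u w')) = 0"
    by (simp add: right_diff_distrib sum_subtractf PP sum_id)
  moreover have "(\<Sum>u\<in>bits M. (id_op u z' - P z' u) * P u w') = 0"
    by (simp add: left_diff_distrib sum_subtractf PP sum_id)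
  moreover have "(\<Sum>u\<in>bits M. (id_op u z' - P z' u) * (id_op u w' - P u w')) = id_op z' w' - P z' w'"
    by (simp add: left_diff_distrib right_diff_distrib sum_subtractf PP sum_id)
  ultimately have "(\<Sum>u\<in>bits (Suc M). cnj (measure_op M P u z) * measure_op M P u w) = (if b = c then id_op z' w' else 0)"
    unfolding sum_bits_Suc z(2) w(2)
    using z(1) w(1) by (cases b; cases c) (simp_all add: measure_op_append cP cid sum.distrib PP cong: sum.cong)
  then show "(\<Sum>u\<in>bits (Suc M). cnj (measure_op M P u z) * measure_op M P u w) = (if z = w then 1 else 0)"
    by (auto simp: id_op_def z(2) w(2))
qed

text \<open>The outcome qubit starts in 0, so exactly the component P \<phi> ends with that qubit
  set, and |P \<phi>|^2 = <\<phi>, P \<phi>> for a projection.\<close>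

lemma prob_one_measure_op:
  assumes P: "projector M P"
    and \<psi>: "\<And>z b. z \<in> bits M \<Longrightarrow> \<psi> (z @ [b]) = (if b then 0 else \<phi> z)"
  shows "complex_of_real (prob_one (Suc M) M (app (Suc M) (measure_op M P) \<psi>)) = inner M \<phi> (app M P \<phi>)"
proof -
  have app: "app (Suc M) (measure_op M P) \<psi> (z @ [True]) = app M P \<phi> z" if "z \<in> bits M" for z
    unfolding app_def sum_bits_Suc using that by (intro sum.cong) (auto simp: measure_op_append \<psi>)
  have "prob_one (Suc M) M (app (Suc M) (measure_op M P) \<psi>) =
      (\<Sum>z\<in>bits (Suc M). if z ! M then (cmod (app (Suc M) (measure_op M P) \<psi> z))\<^sup>2 else 0)"
    by (simp add: prob_one_def sum.inter_filter)
  also have "\<dots> = norm_sq M (app M P \<phi>)"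
    unfolding sum_bits_Suc norm_sq_def by (intro sum.cong) (auto simp: bits_def nth_append app)
  finally have "complex_of_real (prob_one (Suc M) M (app (Suc M) (measure_op M P) \<psi>)) =
      inner M \<phi> (app M (op_mult M (adjoint P) P) \<phi>)"
    by (simp add: inner_self[symmetric] inner_app app_op_mult)
  also have "\<dots> = inner M \<phi> (app M P \<phi>)"
    unfolding inner_def
  proof (intro sum.cong refl arg_cong2[of _ _ _ _ "(*)"] app_cong)
    fix z w assume zw: "z \<in> bits M" "w \<in> bits M"
    then have "op_mult M (adjoint P) P z w = op_mult M P P z w"
      using P by (intro op_mult_cong) (auto simp: adjoint_def projector_def)
    then show "op_mult M (adjoint P) P z w = P z w" using P zw by (simp add: projector_def)
  qed
  finally show ?thesis .
qed

lemma zero_state_append: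
  "length z = M \<Longrightarrow> zero_state (M + K) (z @ w) = zero_state M z * zero_state K w"
  by (auto simp: zero_state_def replicate_add)

lemma replicate_bits [simp]: "replicate L b \<in> bits L"
  by (simp add: bits_def)

lemma zero_state_snoc:
  "m \<in> bits L \<Longrightarrow> zero_state (Suc L) (m @ [b]) = (if m = replicate L False \<and> \<not> b then 1 else 0)"
  using zero_state_append[of m L 1 "[b]"] by (auto simp: bits_def zero_state_def)

text \<open>The all-zero state sees only one column of \<open>W\<close>; this is why state
  preparation prescribes no more than that column.\<close>

lemma app_lift_op_zero_state:
  assumes W: "\<forall>z\<in>bits L. W z (replicate L False) = complex_of_real (\<alpha> z)"
    and N: "N = L + K" and z: "z \<in> bits L" "length w = K"
  shows "app N (lift_op 0 L W) (zero_state N) (z @ w) = complex_of_real (\<alpha> z) * zero_state K w"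
proof -
  have zw: "z @ w \<in> bits N" "segment 0 L (z @ w) = z" using z N by (auto simp: bits_def segment_def)
  have "app N (lift_op 0 L W) (zero_state N) (z @ w) = (\<Sum>m\<in>bits L. W z m * (zero_state L m * zero_state K w))"
    using zw N z by (subst app_lift_op)
      (auto simp: splice_at_def bits_def zero_state_append intro!: sum.cong)
  also have "\<dots> = (\<Sum>m\<in>bits L. if m = replicate L False then W z m * zero_state K w else 0)"
    by (intro sum.cong) (auto simp: zero_state_def)
  also have "\<dots> = complex_of_real (\<alpha> z) * zero_state K w"
    using W z replicate_bits[of L] by simp
  finally show ?thesis .
qed

text \<open>Each party prepares its amplitudes on \<open>L\<close> qubits and sends all of them; the
  referee adds one outcome qubit, the last one, and measures everything. The quantified p expresses
  that the formally complex expectation is a real probability.\<close>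

lemma Q_smp_le_of_projector:
  fixes \<alpha> \<beta> :: "bool list \<Rightarrow> bool list \<Rightarrow> real"
  assumes P: "projector (L + L) P"
    and \<alpha>: "\<And>x. length x = n \<Longrightarrow> (\<Sum>z\<in>bits L. (\<alpha> x z)\<^sup>2) = 1"
    and \<beta>: "\<And>y. length y = n \<Longrightarrow> (\<Sum>z\<in>bits L. (\<beta> y z)\<^sup>2) = 1"
    and correct: "\<And>x y. length x = n \<Longrightarrow> length y = n \<Longrightarrow>
      \<exists>p. inner (L + L) (\<lambda>z. complex_of_real (\<alpha> x (take L z) * \<beta> y (drop L z)))
        (app (L + L) P (\<lambda>z. complex_of_real (\<alpha> x (take L z) * \<beta> y (drop L z)))) = complex_of_real p
        \<and> correct_whp (f x y) p"
  shows "Q_smp n f \<le> L + L"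
proof -
  define N where "N = Suc (L + L)"
  obtain WA where WA: "\<And>x. length x = n \<Longrightarrow> unitary_op L (WA x) \<and>
      (\<forall>z\<in>bits L. WA x z (replicate L False) = complex_of_real (\<alpha> x z))"
    using exists_unitary_first_column[OF \<alpha>] by metis
  obtain WB where WB: "\<And>y. length y = n \<Longrightarrow> unitary_op L (WB y) \<and>
      (\<forall>z\<in>bits L. WB y z (replicate L False) = complex_of_real (\<beta> y z))"
    using exists_unitary_first_column[OF \<beta>] by metis
  define UA where "UA = (\<lambda>x. lift_op 0 L (WA x))"
  define UB where "UB = (\<lambda>y. lift_op L L (WB y))"
  define V where "V = measure_op (L + L) P"
  have state: "app N (UB y) (app N (UA x) (zero_state N)) (z @ [b]) =
      (if b then 0 else complex_of_real (\<alpha> x (take L z) * \<beta> y (drop L z)))"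
    if xy: "length x = n" "length y = n" and z: "z \<in> bits (L + L)" for x y z b
  proof -
    have 1: "z @ [b] \<in> bits N" "L + L \<le> N" "segment L L (z @ [b]) = drop L z"
      using z by (auto simp: N_def bits_def segment_def)
    have "app N (UB y) (app N (UA x) (zero_state N)) (z @ [b]) =
      (\<Sum>m\<in>bits L. WB y (drop L z) m * app N (UA x) (zero_state N) (take L z @ (m @ [b])))"
      unfolding UB_def app_lift_op[OF 1(2,1)] 1(3)
      using z by (intro sum.cong) (auto simp: splice_at_def bits_def)
    also have "\<dots> = (\<Sum>m\<in>bits L. WB y (drop L z) m * (complex_of_real (\<alpha> x (take L z)) * zero_state (Suc L) (m @ [b])))"
      unfolding UA_def using WA[OF xy(1)] z
      by (intro sum.cong arg_cong2[of _ _ _ _ "(*)"] refl app_lift_op_zero_state) (auto simp: N_def bits_def)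
    also have "\<dots> = (\<Sum>m\<in>bits L. if m = replicate L False then
        (if b then 0 else WB y (drop L z) m * complex_of_real (\<alpha> x (take L z))) else 0)"
      by (intro sum.cong) (auto simp: zero_state_snoc)
    also have "\<dots> = (if b then 0 else complex_of_real (\<alpha> x (take L z) * \<beta> y (drop L z)))"
    proof -
      have "drop L z \<in> bits L" using z by (simp add: bits_def)
      then show ?thesis using WB[OF xy(2)] by simp
    qed
    finally show ?thesis .
  qed
  have sets: "{0..<L} \<union> {L..<L + L} \<union> ({0..<N} - {0..<L} - {L..<L + L}) = {0..<N}"
    by (auto simp: N_def)
  have "smp_computes n f N {0..<L} {L..<L + L} {0..<L} {L..<L + L} UA UB V (L + L)"
    unfolding smp_computes_def Let_def sets
  proof (intro conjI allI impI)
    fix x y :: "bool list" assume x: "length x = n" and y: "length y = n"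
    obtain p where p: "inner (L + L) (\<lambda>z. complex_of_real (\<alpha> x (take L z) * \<beta> y (drop L z)))
        (app (L + L) P (\<lambda>z. complex_of_real (\<alpha> x (take L z) * \<beta> y (drop L z)))) = complex_of_real p"
        "correct_whp (f x y) p"
      using correct[OF x y] by blast
    have "complex_of_real (prob_one N (L + L) (app N V (app N (UB y) (app N (UA x) (zero_state N))))) = complex_of_real p"
      unfolding p(1)[symmetric] V_def
      using prob_one_measure_op[OF P state[OF x y]] by (simp add: N_def)
    then show "correct_whp (f x y) (prob_one N (L + L) (app N V (app N (UB y) (app N (UA x) (zero_state N)))))"
      using p(2) by simp
  next
    fix x :: "bool list" assume "length x = n"
    then show "unitary_op N (UA x)" "acts_on N {0..<L} (UA x)"
      using WA acts_on_lift_op[of 0 L N "WA x"] by (auto simp: UA_def N_def intro: unitary_lift_op)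
  next
    fix y :: "bool list" assume "length y = n"
    then show "unitary_op N (UB y)" "acts_on N {L..<L + L} (UB y)"
      using WB by (auto simp: UB_def N_def intro: unitary_lift_op acts_on_lift_op)
  qed (use unitary_measure_op[OF P] acts_on_everything in \<open>auto simp: V_def N_def\<close>)
  then have "\<exists>N SA SB MA MB UA UB V q. smp_computes n f N SA SB MA MB UA UB V q \<and> card MA + card MB = L + L"
    by (intro exI[of _ N] exI[of _ "{0..<L}"] exI[of _ "{L..<L + L}"] exI[of _ UA] exI[of _ UB] exI[of _ V] exI[of _ "L + L"]) auto
  then show ?thesis unfolding Q_smp_def by (rule Least_le)
qed

text \<open>\<open>Q_ent\<close> is a \<open>LEAST\<close>, which is informative only if some
  protocol exists. In the trivial one Alice writes x into n qubits and sends them, and Bob measures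
  the projection onto the basis states z with \<open>f z y\<close>.\<close>

lemma ent_protocol_exists: "\<exists>N A \<psi>0 rs q. ent_computes n f N A \<psi>0 rs q"
proof -
  define N where "N = Suc n"
  define \<alpha> :: "bool list \<Rightarrow> bool list \<Rightarrow> real" where "\<alpha> = (\<lambda>x z. if z = x then 1 else 0)"
  have \<alpha>: "(\<Sum>z\<in>bits n. (\<alpha> x z)\<^sup>2) = 1" if "length x = n" for x
  proof -
    have "(\<Sum>z\<in>bits n. (\<alpha> x z)\<^sup>2) = (\<Sum>z\<in>bits n. if z = x then 1 else 0)"
      by (intro sum.cong) (auto simp: \<alpha>_def)
    moreover have "x \<in> bits n" using that by (simp add: bits_def)
    ultimately show ?thesis by simp
  qed
  obtain W where W: "\<And>x. length x = n \<Longrightarrow> unitary_op n (W x) \<and>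
      (\<forall>z\<in>bits n. W x z (replicate n False) = complex_of_real (\<alpha> x z))"
    using exists_unitary_first_column[OF \<alpha>] by metis
  define P :: "bool list \<Rightarrow> qop" where "P = (\<lambda>y z w. if z = w \<and> f z y then 1 else 0)"
  have P: "projector n (P y)" for y
    unfolding projector_def
  proof (intro ballI conjI)
    fix z w assume "z \<in> bits n" "w \<in> bits n"
    have "op_mult n (P y) (P y) z w = (\<Sum>u\<in>bits n. if u = z then P y z w else 0)"
      unfolding op_mult_def by (intro sum.cong) (auto simp: P_def)
    then show "op_mult n (P y) (P y) z w = P y z w" using \<open>z \<in> bits n\<close> by simp
  qed (auto simp: P_def)
  \<comment> \<open>Bob's round transfers nothing: it is only his measurement, whose outcome goes to
    qubit n, his from the start.\<close>
  define rs where "rs = [(True, \<lambda>x. lift_op 0 n (W x), {0..<n}), (False, \<lambda>y. measure_op n (P y), {})]"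
  have "ent_computes n f N {0..<n} (zero_state N) rs n"
    unfolding ent_computes_def
  proof (intro conjI allI impI)
    have "(\<Sum>z\<in>bits N. (cmod (zero_state N z))\<^sup>2) = (\<Sum>z\<in>bits N. if z = replicate N False then 1 else 0)"
      by (intro sum.cong) (auto simp: zero_state_def)
    then show "unit_vec N (zero_state N)" by (simp add: unit_vec_def)
    have "unitary_op N (lift_op 0 n (W x)) \<and> acts_on N {0..<n} (lift_op 0 n (W x))" if "length x = n" for x
      using W that acts_on_lift_op[of 0 n N "W x"] by (auto simp: N_def intro: unitary_lift_op)
    moreover have "unitary_op N (measure_op n (P y)) \<and> acts_on N {0..<N} (measure_op n (P y))" for y
      using unitary_measure_op[OF P] acts_on_everything by (auto simp: N_def)
    ultimately show "valid_rounds N n {0..<n} rs" by (simp add: rs_def)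
    fix x y :: "bool list" assume x: "length x = n" and y: "length y = n"
    have state: "app N (lift_op 0 n (W x)) (zero_state N) (z @ [b]) = (if b then 0 else complex_of_real (\<alpha> x z))"
      if "z \<in> bits n" for z b
      using app_lift_op_zero_state[of n "W x" "\<alpha> x" N 1 z "[b]"] W[OF x] that by (simp add: N_def zero_state_def)
    have "complex_of_real (prob_one N n (run N x y rs (zero_state N))) =
        inner n (\<lambda>z. complex_of_real (\<alpha> x z)) (app n (P y) (\<lambda>z. complex_of_real (\<alpha> x z)))"
      using prob_one_measure_op[OF P state, of y] by (simp add: rs_def N_def)
    also have "\<dots> = (\<Sum>z\<in>bits n. if z = x then if f x y then 1 else 0 else 0)"
      unfolding inner_def
    proof (intro sum.cong refl)
      fix z assume z: "z \<in> bits n"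
      have "app n (P y) (\<lambda>z. complex_of_real (\<alpha> x z)) z = (\<Sum>w\<in>bits n. if w = z then if f z y then complex_of_real (\<alpha> x z) else 0 else 0)"
        unfolding app_def by (intro sum.cong) (auto simp: P_def)
      then show "cnj (complex_of_real (\<alpha> x z)) * app n (P y) (\<lambda>z. complex_of_real (\<alpha> x z)) z = (if z = x then if f x y then 1 else 0 else 0)"
        using z by (auto simp: \<alpha>_def)
    qed
    also have "\<dots> = (if f x y then 1 else 0)"
    proof -
      have "x \<in> bits n" using x by (simp add: bits_def)
      then show ?thesis by simp
    qed
    finally have "prob_one N n (run N x y rs (zero_state N)) = (if f x y then 1 else 0)"
      by (metis of_real_eq_iff of_real_1 of_real_0)
    then show "correct_whp (f x y) (prob_one N n (run N x y rs (zero_state N)))"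
      by (simp add: correct_whp_def)
  qed (auto simp: N_def rs_def)
  then show ?thesis by blast
qed

section \<open>Repeated swap tests\<close>

lemma card_bits: "card (bits N) = 2 ^ N"
  using card_lists_length_eq[of "UNIV :: bool set" N] by (simp add: bits_def)

text \<open>Outcomes are read as +1 and -1 so that the mean of a swap test is the squared inner
  product itself.\<close>

definition swap_sign :: "bool \<Rightarrow> real" where
  "swap_sign c = (if c then 1 else - 1)"

text \<open>The projections onto the symmetric (\<open>c = True\<close>) and antisymmetric (\<open>c = False\<close>) vectors,
  i.e. onto the two outcomes of a swap test.\<close>
definition swap_proj :: "bool \<Rightarrow> 'i \<times> 'i \<Rightarrow> 'i \<times> 'i \<Rightarrow> real" where
  "swap_proj c y y' = ((if y = y' then 1 else 0) + swap_sign c * (if y = prod.swap y' then 1 else 0)) / 2"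

lemma swap_proj_sym: "swap_proj c y y' = swap_proj c y' y"
  by (auto simp: swap_proj_def)

text \<open>The operators are (1 + SWAP) / 2 and (1 - SWAP) / 2, and SWAP squares to the
  identity.\<close>

lemma swap_proj_mult:
  assumes "finite I" "y \<in> I \<times> I" "y' \<in> I \<times> I"
  shows "(\<Sum>x\<in>I \<times> I. swap_proj c y x * swap_proj d x y') = (if c = d then swap_proj c y y' else 0)"
proof -
  let ?\<delta> = "\<lambda>y y' :: 'a \<times> 'a. if y = y' then 1 else 0 :: real"
  have \<delta>: "(\<Sum>x\<in>I \<times> I. ?\<delta> x z * g x) = g z" if "z \<in> I \<times> I" for z g
    using that assms(1) by (simp add: if_distrib[of "\<lambda>a. a * _"] cong: if_cong)
  have "(\<Sum>x\<in>I \<times> I. swap_proj c y x * swap_proj d x y') =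
      (\<Sum>x\<in>I \<times> I. ?\<delta> x y * (swap_proj d x y' / 2) + ?\<delta> x (prod.swap y) * (swap_sign c * swap_proj d x y' / 2))"
    by (intro sum.cong) (auto simp: swap_proj_def[of c] field_simps)
  also have "\<dots> = swap_proj d y y' / 2 + swap_sign c * swap_proj d (prod.swap y) y' / 2"
    unfolding sum.distrib using assms by (subst (1 2) \<delta>) auto
  also have "\<dots> = (if c = d then swap_proj c y y' else 0)"
  proof -
    have swap: "prod.swap y = prod.swap y' \<longleftrightarrow> y = y'" "prod.swap y = y' \<longleftrightarrow> y = prod.swap y'"
      by (cases y; cases y'; auto)+
    show ?thesis by (cases c; cases d) (simp_all add: swap_proj_def swap_sign_def swap)
  qed
  finally show ?thesis .
qed

text \<open>The expectation of SWAP in the product of u and v is <u, v>^2, which is all that a swap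
  test sees.\<close>

lemma swap_proj_expectation:
  fixes u v :: "'i \<Rightarrow> real"
  assumes "finite I" "(\<Sum>i\<in>I. (u i)\<^sup>2) = 1" "(\<Sum>i\<in>I. (v i)\<^sup>2) = 1"
  defines "\<phi> \<equiv> \<lambda>y. u (fst y) * v (snd y)"
  shows "(\<Sum>y\<in>I \<times> I. \<Sum>y'\<in>I \<times> I. \<phi> y * swap_proj c y y' * \<phi> y') =
    (1 + swap_sign c * (\<Sum>i\<in>I. u i * v i)\<^sup>2) / 2"
proof -
  have "(\<Sum>y'\<in>I \<times> I. \<phi> y * swap_proj c y y' * \<phi> y') =
      (\<phi> y * \<phi> y + swap_sign c * (\<phi> y * \<phi> (prod.swap y))) / 2" if y: "y \<in> I \<times> I" for y
  proof -
    have "(\<Sum>y'\<in>I \<times> I. \<phi> y * swap_proj c y y' * \<phi> y') =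
        (\<Sum>y'\<in>I \<times> I. (if y' = y then \<phi> y * \<phi> y' / 2 else 0) +
          (if y' = prod.swap y then swap_sign c * (\<phi> y * \<phi> y') / 2 else 0))"
    proof (intro sum.cong refl)
      fix y'
      have "y = prod.swap y' \<longleftrightarrow> y' = prod.swap y" by (cases y; cases y') auto
      moreover have "y = y' \<longleftrightarrow> y' = y" by auto
      ultimately show "\<phi> y * swap_proj c y y' * \<phi> y' = (if y' = y then \<phi> y * \<phi> y' / 2 else 0) +
          (if y' = prod.swap y then swap_sign c * (\<phi> y * \<phi> y') / 2 else 0)"
        unfolding swap_proj_def by (simp add: field_simps)
    qed
    also have "\<dots> = (\<phi> y * \<phi> y + swap_sign c * (\<phi> y * \<phi> (prod.swap y))) / 2"
      using y assms(1) by (auto simp: sum.distrib add_divide_distrib)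
    finally show ?thesis .
  qed
  then have "(\<Sum>y\<in>I \<times> I. \<Sum>y'\<in>I \<times> I. \<phi> y * swap_proj c y y' * \<phi> y') =
      (\<Sum>y\<in>I \<times> I. (\<phi> y * \<phi> y + swap_sign c * (\<phi> y * \<phi> (prod.swap y))) / 2)"
    by (intro sum.cong) auto
  also have "\<dots> = ((\<Sum>y\<in>I \<times> I. \<phi> y * \<phi> y) + swap_sign c * (\<Sum>y\<in>I \<times> I. \<phi> y * \<phi> (prod.swap y))) / 2"
    by (simp add: sum.distrib sum_divide_distrib[symmetric] sum_distrib_left[symmetric])
  also have "(\<Sum>y\<in>I \<times> I. \<phi> y * \<phi> y) = (\<Sum>i\<in>I. (u i)\<^sup>2) * (\<Sum>k\<in>I. (v k)\<^sup>2)"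
    by (simp add: sum_product sum.cartesian_product' \<phi>_def power2_eq_square mult_ac)
  also have "(\<Sum>y\<in>I \<times> I. \<phi> y * \<phi> (prod.swap y)) = (\<Sum>i\<in>I. u i * v i)\<^sup>2"
    by (simp add: sum_product sum.cartesian_product' \<phi>_def power2_eq_square mult_ac)
  finally show ?thesis using assms by simp
qed

lemma inner_product_sq_le_1:
  fixes u v :: "'i \<Rightarrow> real"
  assumes "finite I" "(\<Sum>i\<in>I. (u i)\<^sup>2) = 1" "(\<Sum>i\<in>I. (v i)\<^sup>2) = 1"
  shows "(\<Sum>i\<in>I. u i * v i)\<^sup>2 \<le> 1"
proof -
  have "\<bar>\<Sum>i\<in>I. u i * v i\<bar> \<le> (\<Sum>i\<in>I. ((u i)\<^sup>2 + (v i)\<^sup>2) / 2)"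
  proof (rule order_trans[OF sum_abs sum_mono])
    fix i
    show "\<bar>u i * v i\<bar> \<le> ((u i)\<^sup>2 + (v i)\<^sup>2) / 2"
      using sum_squares_bound[of "\<bar>u i\<bar>" "\<bar>v i\<bar>"] by (simp add: abs_mult)
  qed
  also have "\<dots> = 1" using assms by (simp add: sum_divide_distrib[symmetric] sum.distrib)
  finally show ?thesis by (simp add: abs_square_le_1)
qed

text \<open>The outcomes are independent with mean \<mu>, at distance at least e from \<tau>. The
  one-sided bound is applied to \<open>swap_sign\<close> on \<open>G\<close> if \<mu> is below the
  threshold, and to its negative on the complement if it is above. K e^2 >= 8 makes the failure
  probability at most exp (-2) <= 1/3.\<close>

lemma threshold_test:
  fixes \<mu> \<tau> e :: real
  assumes \<mu>: "0 \<le> \<mu>" "\<mu> \<le> 1" and e: "0 \<le> e" "e \<le> 1" and K: "real K * e\<^sup>2 \<ge> 8"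
  defines "G \<equiv> {s \<in> {..<K} \<rightarrow>\<^sub>E UNIV. (\<Sum>j<K. swap_sign (s j)) \<ge> real K * \<tau>}"
  defines "p \<equiv> \<Sum>s\<in>G. \<Prod>j<K. (1 + swap_sign (s j) * \<mu>) / 2"
  shows "\<mu> \<ge> \<tau> + e \<Longrightarrow> p \<ge> 2 / 3" and "\<mu> \<le> \<tau> - e \<Longrightarrow> p \<le> 1 / 3"
proof -
  let ?r = "\<lambda>c. (1 + swap_sign c * \<mu>) / 2"
  let ?\<Omega> = "{..<K} \<rightarrow>\<^sub>E (UNIV :: bool set)"
  have r: "?r c \<ge> 0" "sum ?r UNIV = 1" for c
    using \<mu> by (auto simp: swap_sign_def UNIV_bool field_simps)
  have fin: "finite ?\<Omega>" by (intro finite_PiE) auto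
  have "exp (- (real K * e\<^sup>2 / 4)) \<le> exp (- 2)" using K by simp
  also have "\<dots> \<le> 1 / (3 :: real)"
    using exp_ge_add_one_self[of 2] by (simp add: exp_minus field_simps)
  finally have small: "exp (- (real K * e\<^sup>2 / 4)) \<le> 1 / 3" .
  have Eh: "(\<Sum>c\<in>UNIV. ?r c * swap_sign c) = \<mu>"
    by (simp add: UNIV_bool swap_sign_def field_simps)
  show "p \<le> 1 / 3" if "\<mu> \<le> \<tau> - e"
  proof -
    have "p \<le> exp (- (real K * e\<^sup>2 / 4))"
      unfolding p_def
    proof (rule hoeffding_product[where Y = UNIV and h = swap_sign])
      fix s assume "s \<in> G"
      moreover have "real K * (\<mu> + e) \<le> real K * \<tau>" using that by (intro mult_left_mono) auto
      ultimately show "real K * ((\<Sum>c\<in>UNIV. ?r c * swap_sign c) + e) \<le> (\<Sum>j<K. swap_sign (s j))"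
        unfolding Eh G_def by auto
    qed (use r e in \<open>auto simp: G_def swap_sign_def\<close>)
    then show ?thesis using small by simp
  qed
  show "p \<ge> 2 / 3" if "\<mu> \<ge> \<tau> + e"
  proof -
    have "(\<Sum>s\<in>?\<Omega> - G. \<Prod>j<K. ?r (s j)) \<le> exp (- (real K * e\<^sup>2 / 4))"
    proof (rule hoeffding_product[where Y = UNIV and h = "\<lambda>c. - swap_sign c"])
      fix s assume "s \<in> ?\<Omega> - G"
      then have "(\<Sum>j<K. swap_sign (s j)) \<le> real K * \<tau>"
        unfolding G_def by (metis (no_types, lifting) DiffE linear mem_Collect_eq)
      moreover have "real K * \<tau> \<le> real K * (\<mu> - e)" using that by (intro mult_left_mono) auto
      ultimately show "real K * ((\<Sum>c\<in>UNIV. ?r c * - swap_sign c) + e) \<le> (\<Sum>j<K. - swap_sign (s j))"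
      proof -
        have "(\<Sum>c\<in>UNIV. ?r c * - swap_sign c) = - \<mu>"
          unfolding mult_minus_right sum_negf Eh ..
        then show ?thesis
          using \<open>(\<Sum>j<K. swap_sign (s j)) \<le> real K * \<tau>\<close> \<open>real K * \<tau> \<le> real K * (\<mu> - e)\<close>
          by (simp only: sum_negf) (simp add: algebra_simps)
      qed
    qed (use r e in \<open>auto simp: swap_sign_def\<close>)
    moreover have "(\<Sum>s\<in>?\<Omega> - G. \<Prod>j<K. ?r (s j)) + p = (\<Sum>s\<in>?\<Omega>. \<Prod>j<K. ?r (s j))"
      unfolding p_def using fin by (intro sum.subset_diff[symmetric]) (unfold G_def, blast)
    moreover have "(\<Sum>s\<in>?\<Omega>. \<Prod>j<K. ?r (s j)) = (\<Prod>j<K. sum ?r UNIV)"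
      by (rule prod_sum_PiE[symmetric]) auto
    ultimately show ?thesis using small r by simp
  qed
qed

lemma sum_PiE_PiE:
  fixes F :: "nat \<Rightarrow> 'a \<Rightarrow> 'a \<Rightarrow> real"
  assumes "finite Y"
  shows "(\<Sum>\<omega>\<in>{..<K} \<rightarrow>\<^sub>E Y. \<Sum>\<omega>'\<in>{..<K} \<rightarrow>\<^sub>E Y. \<Prod>j<K. F j (\<omega> j) (\<omega>' j)) =
    (\<Prod>j<K. \<Sum>y\<in>Y. \<Sum>y'\<in>Y. F j y y')"
proof -
  have "(\<Sum>\<omega>'\<in>{..<K} \<rightarrow>\<^sub>E Y. \<Prod>j<K. F j (\<omega> j) (\<omega>' j)) = (\<Prod>j<K. \<Sum>y'\<in>Y. F j (\<omega> j) y')" for \<omega>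
    by (rule prod_sum_PiE[symmetric]) (use assms in auto)
  moreover have "(\<Sum>\<omega>\<in>{..<K} \<rightarrow>\<^sub>E Y. \<Prod>j<K. \<Sum>y'\<in>Y. F j (\<omega> j) y') = (\<Prod>j<K. \<Sum>y\<in>Y. \<Sum>y'\<in>Y. F j y y')"
    by (rule prod_sum_PiE[symmetric]) (use assms in auto)
  ultimately show ?thesis by simp
qed

text \<open>All K tests and the threshold form one projective measurement: summing the tensor
  products of \<open>swap_proj\<close> over the accepted outcome strings gives a projection, as
  different strings give orthogonal products. Each party sends K copies of its m-qubit
  state.\<close>

lemma Q_smp_le_of_swap_test:
  fixes u v :: "bool list \<Rightarrow> 'i \<Rightarrow> real"
  assumes I: "finite I" "card I = 2 ^ m"
    and u: "\<And>x. length x = n \<Longrightarrow> (\<Sum>i\<in>I. (u x i)\<^sup>2) = 1"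
    and v: "\<And>y. length y = n \<Longrightarrow> (\<Sum>i\<in>I. (v y i)\<^sup>2) = 1"
    and e: "0 \<le> e" "e \<le> 1" and K: "real K * e\<^sup>2 \<ge> 8"
    and gap: "\<And>x y. length x = n \<Longrightarrow> length y = n \<Longrightarrow>
      if f x y then (\<Sum>i\<in>I. u x i * v y i)\<^sup>2 \<ge> \<tau> + e else (\<Sum>i\<in>I. u x i * v y i)\<^sup>2 \<le> \<tau> - e"
  shows "Q_smp n f \<le> 2 * (K * m)"
proof -
  define L where "L = K * m"
  define D where "D = {..<K} \<rightarrow>\<^sub>E I"
  define \<Omega> where "\<Omega> = {..<K} \<rightarrow>\<^sub>E (I \<times> I)"
  define G where "G = {s \<in> {..<K} \<rightarrow>\<^sub>E (UNIV :: bool set). (\<Sum>j<K. swap_sign (s j)) \<ge> real K * \<tau>}"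
  have "finite ({..<K} \<rightarrow>\<^sub>E (UNIV :: bool set))" by (intro finite_PiE) auto
  then have finG: "finite G" by (simp add: G_def)
  have "finite D" unfolding D_def using I by (intro finite_PiE) auto
  moreover have "card D = card (bits L)"
    by (simp add: D_def card_PiE card_bits I L_def power_mult[symmetric] mult.commute)
  \<comment> \<open>Any bijection between L-bit strings and K-tuples over \<open>I\<close> will do,
    since amplitudes and projections are defined on the tuples.\<close>
  ultimately obtain g where g: "bij_betw g (bits L) D"
    using finite_same_card_bij[of "bits L" D] by auto
  have gD: "g z \<in> D" if "z \<in> bits L" for z using g that by (auto simp: bij_betw_def)
  \<comment> \<open>Alice's and Bob's tuples are regrouped into K pairs, one for each swap
    test.\<close>
  define enc where "enc = (\<lambda>z. \<lambda>j\<in>{..<K}. (g (take L z) j, g (drop L z) j))"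
  have halves: "take L z \<in> bits L" "drop L z \<in> bits L" if "z \<in> bits (L + L)" for z
    using that by (auto simp: bits_def)
  have enc: "bij_betw enc (bits (L + L)) \<Omega>"
  proof -
    have inj: "inj_on enc (bits (L + L))"
    proof (rule inj_onI)
      fix z w assume z: "z \<in> bits (L + L)" and w: "w \<in> bits (L + L)" and eq: "enc z = enc w"
      have "g (take L z) j = g (take L w) j \<and> g (drop L z) j = g (drop L w) j" if "j < K" for j
        using fun_cong[OF eq, of j] that by (simp add: enc_def)
      then have "g (take L z) = g (take L w)" "g (drop L z) = g (drop L w)"
        using PiE_ext[OF gD[OF halves(1)[OF z], unfolded D_def] gD[OF halves(1)[OF w], unfolded D_def]]
          PiE_ext[OF gD[OF halves(2)[OF z], unfolded D_def] gD[OF halves(2)[OF w], unfolded D_def]]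
        by auto
      then have "take L z = take L w" "drop L z = drop L w"
        using g halves z w by (auto simp: bij_betw_def inj_on_def)
      then show "z = w" by (metis append_take_drop_id[of L z] append_take_drop_id[of L w])
    qed
    have "enc ` bits (L + L) \<subseteq> \<Omega>"
    proof
      fix \<omega> assume "\<omega> \<in> enc ` bits (L + L)"
      then obtain z where z: "z \<in> bits (L + L)" "\<omega> = enc z" by auto
      have "g (take L z) j \<in> I \<and> g (drop L z) j \<in> I" if "j < K" for j
        using gD[OF halves(1)[OF z(1)]] gD[OF halves(2)[OF z(1)]] that by (auto simp: D_def PiE_iff)
      then show "\<omega> \<in> \<Omega>" by (auto simp: z(2) enc_def \<Omega>_def)
    qed
    moreover have fin: "finite \<Omega>" unfolding \<Omega>_def using I by (intro finite_PiE) auto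
    moreover have "card (enc ` bits (L + L)) = card \<Omega>"
      unfolding card_image[OF inj] card_bits
      by (simp add: \<Omega>_def card_PiE I card_cartesian_product L_def power_add power_mult power_mult_distrib mult.commute[of K])
    ultimately have "enc ` bits (L + L) = \<Omega>" by (intro card_subset_eq)
    then show ?thesis using inj by (simp add: bij_betw_def)
  qed
  have sum_enc: "(\<Sum>z\<in>bits (L + L). F (enc z)) = (\<Sum>\<omega>\<in>\<Omega>. F \<omega>)" for F :: "_ \<Rightarrow> real"
    by (rule sum.reindex_bij_betw[OF enc])
  have enc_in: "enc z \<in> \<Omega>" if "z \<in> bits (L + L)" for z
    using enc that by (auto simp: bij_betw_def)
  define R where "R = (\<lambda>\<omega> \<omega>'. \<Sum>s\<in>G. \<Prod>j<K. swap_proj (s j) (\<omega> j :: 'i \<times> 'i) (\<omega>' j))"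
  define P :: qop where "P = (\<lambda>z w. complex_of_real (R (enc z) (enc w)))"
  have RR: "(\<Sum>\<omega>\<in>\<Omega>. R \<omega>1 \<omega> * R \<omega> \<omega>2) = R \<omega>1 \<omega>2" if \<omega>: "\<omega>1 \<in> \<Omega>" "\<omega>2 \<in> \<Omega>" for \<omega>1 \<omega>2
  proof -
    have st: "(\<Sum>\<omega>\<in>\<Omega>. \<Prod>j<K. swap_proj (s j) (\<omega>1 j) (\<omega> j) * swap_proj (t j) (\<omega> j) (\<omega>2 j)) =
        (if t = s then \<Prod>j<K. swap_proj (s j) (\<omega>1 j) (\<omega>2 j) else 0)" if "s \<in> G" "t \<in> G" for s t
    proof -
      have "(\<Sum>\<omega>\<in>\<Omega>. \<Prod>j<K. swap_proj (s j) (\<omega>1 j) (\<omega> j) * swap_proj (t j) (\<omega> j) (\<omega>2 j)) =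
          (\<Prod>j<K. \<Sum>y\<in>I \<times> I. swap_proj (s j) (\<omega>1 j) y * swap_proj (t j) y (\<omega>2 j))"
        unfolding \<Omega>_def by (rule prod_sum_PiE[symmetric]) (use I in auto)
      also have "\<dots> = (\<Prod>j<K. if s j = t j then swap_proj (s j) (\<omega>1 j) (\<omega>2 j) else 0)"
        using \<omega> I by (intro prod.cong refl swap_proj_mult) (auto simp: \<Omega>_def PiE_iff)
      also have "\<dots> = (if t = s then \<Prod>j<K. swap_proj (s j) (\<omega>1 j) (\<omega>2 j) else 0)"
      \<comment> \<open>Different outcome strings are extensional, so they differ at some index
        below K, where the factor is 0.\<close>
      proof (cases "t = s")
        case False
        have "\<not> (\<forall>j\<in>{..<K}. s j = t j)"
        proof
          assume "\<forall>j\<in>{..<K}. s j = t j"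
          then have "s = t"
            using that by (intro PiE_ext[of s "{..<K}" "\<lambda>_. UNIV" t]) (auto simp: G_def)
          then show False using False by simp
        qed
        then obtain j where "j < K" "s j \<noteq> t j" by auto
        then show ?thesis using False by (auto intro!: prod_zero)
      qed simp
      finally show ?thesis .
    qed
    have "(\<Sum>\<omega>\<in>\<Omega>. R \<omega>1 \<omega> * R \<omega> \<omega>2) =
        (\<Sum>\<omega>\<in>\<Omega>. \<Sum>s\<in>G. \<Sum>t\<in>G. \<Prod>j<K. swap_proj (s j) (\<omega>1 j) (\<omega> j) * swap_proj (t j) (\<omega> j) (\<omega>2 j))"
      unfolding R_def sum_product prod.distrib ..
    also have "\<dots> = (\<Sum>s\<in>G. \<Sum>\<omega>\<in>\<Omega>. \<Sum>t\<in>G. \<Prod>j<K. swap_proj (s j) (\<omega>1 j) (\<omega> j) * swap_proj (t j) (\<omega> j) (\<omega>2 j))"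
      by (rule sum.swap)
    also have "\<dots> = (\<Sum>s\<in>G. \<Sum>t\<in>G. \<Sum>\<omega>\<in>\<Omega>. \<Prod>j<K. swap_proj (s j) (\<omega>1 j) (\<omega> j) * swap_proj (t j) (\<omega> j) (\<omega>2 j))"
      by (intro sum.cong refl sum.swap)
    also have "\<dots> = (\<Sum>s\<in>G. \<Sum>t\<in>G. if t = s then \<Prod>j<K. swap_proj (s j) (\<omega>1 j) (\<omega>2 j) else 0)"
      by (intro sum.cong refl st)
    also have "\<dots> = R \<omega>1 \<omega>2" unfolding R_def using finG by (intro sum.cong) auto
    finally show ?thesis .
  qed
  have P: "projector (L + L) P"
    unfolding projector_def
  proof (intro ballI conjI)
    fix z w assume z: "z \<in> bits (L + L)" and w: "w \<in> bits (L + L)"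
    have "R \<omega> \<omega>' = R \<omega>' \<omega>" for \<omega> \<omega>'
      unfolding R_def by (intro sum.cong prod.cong refl swap_proj_sym)
    then show "cnj (P w z) = P z w" by (simp add: P_def)
    have "op_mult (L + L) P P z w = complex_of_real (\<Sum>u\<in>bits (L + L). R (enc z) (enc u) * R (enc u) (enc w))"
      by (simp add: op_mult_def P_def)
    then show "op_mult (L + L) P P z w = P z w"
      using RR[OF enc_in[OF z] enc_in[OF w]] by (simp only: P_def sum_enc[of "\<lambda>\<omega>. R (enc z) \<omega> * R \<omega> (enc w)"])
  qed
  define \<alpha> where "\<alpha> = (\<lambda>x a. \<Prod>j<K. u x (g a j))"
  define \<beta> where "\<beta> = (\<lambda>y a. \<Prod>j<K. v y (g a j))"
  have unit: "(\<Sum>a\<in>bits L. (\<Prod>j<K. c (g a j))\<^sup>2) = 1" if "(\<Sum>i\<in>I. (c i)\<^sup>2) = 1" for c :: "'i \<Rightarrow> real"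
  proof -
    have "(\<Sum>a\<in>bits L. (\<Prod>j<K. c (g a j))\<^sup>2) = (\<Sum>d\<in>D. \<Prod>j<K. (c (d j))\<^sup>2)"
      using sum.reindex_bij_betw[OF g, of "\<lambda>d. \<Prod>j<K. (c (d j))\<^sup>2"] by (simp add: prod_power_distrib)
    also have "\<dots> = (\<Prod>j<K. \<Sum>i\<in>I. (c i)\<^sup>2)"
      unfolding D_def by (rule prod_sum_PiE[symmetric]) (use I in auto)
    finally show ?thesis using that by simp
  qed
  have "Q_smp n f \<le> L + L"
  proof (rule Q_smp_le_of_projector[OF P, where \<alpha> = \<alpha> and \<beta> = \<beta>])
    fix x :: "bool list" assume "length x = n"
    then show "(\<Sum>z\<in>bits L. (\<alpha> x z)\<^sup>2) = 1" "(\<Sum>z\<in>bits L. (\<beta> x z)\<^sup>2) = 1"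
      unfolding \<alpha>_def \<beta>_def by (auto intro: unit u v)
  next
    fix x y :: "bool list" assume x: "length x = n" and y: "length y = n"
    define \<mu> where "\<mu> = (\<Sum>i\<in>I. u x i * v y i)\<^sup>2"
    define \<phi> where "\<phi> = (\<lambda>y'. u x (fst y') * v y (snd y'))"
    define p where "p = (\<Sum>s\<in>G. \<Prod>j<K. (1 + swap_sign (s j) * \<mu>) / 2)"
    have \<Phi>: "\<alpha> x (take L z) * \<beta> y (drop L z) = (\<Prod>j<K. \<phi> (enc z j))" for z
      by (simp add: \<alpha>_def \<beta>_def \<phi>_def enc_def prod.distrib)
    have "inner (L + L) (\<lambda>z. complex_of_real (\<alpha> x (take L z) * \<beta> y (drop L z)))
        (app (L + L) P (\<lambda>z. complex_of_real (\<alpha> x (take L z) * \<beta> y (drop L z)))) =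
      complex_of_real (\<Sum>z\<in>bits (L + L). (\<Prod>j<K. \<phi> (enc z j)) *
        (\<Sum>w\<in>bits (L + L). R (enc z) (enc w) * (\<Prod>j<K. \<phi> (enc w j))))"
      unfolding \<Phi> by (simp add: inner_def app_def P_def)
    also have "\<dots> = complex_of_real (\<Sum>\<omega>\<in>\<Omega>. (\<Prod>j<K. \<phi> (\<omega> j)) * (\<Sum>\<omega>'\<in>\<Omega>. R \<omega> \<omega>' * (\<Prod>j<K. \<phi> (\<omega>' j))))"
      by (simp only: sum_enc[of "\<lambda>\<omega>'. R _ \<omega>' * (\<Prod>j<K. \<phi> (\<omega>' j))"]
        sum_enc[of "\<lambda>\<omega>. (\<Prod>j<K. \<phi> (\<omega> j)) * (\<Sum>\<omega>'\<in>\<Omega>. R \<omega> \<omega>' * (\<Prod>j<K. \<phi> (\<omega>' j)))"])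
    also have "(\<Sum>\<omega>\<in>\<Omega>. (\<Prod>j<K. \<phi> (\<omega> j)) * (\<Sum>\<omega>'\<in>\<Omega>. R \<omega> \<omega>' * (\<Prod>j<K. \<phi> (\<omega>' j)))) =
        (\<Sum>\<omega>\<in>\<Omega>. \<Sum>\<omega>'\<in>\<Omega>. \<Sum>s\<in>G. \<Prod>j<K. \<phi> (\<omega> j) * swap_proj (s j) (\<omega> j) (\<omega>' j) * \<phi> (\<omega>' j))"
      unfolding R_def by (simp add: sum_distrib_left sum_distrib_right prod.distrib mult.assoc)
    also have "\<dots> = (\<Sum>\<omega>\<in>\<Omega>. \<Sum>s\<in>G. \<Sum>\<omega>'\<in>\<Omega>. \<Prod>j<K. \<phi> (\<omega> j) * swap_proj (s j) (\<omega> j) (\<omega>' j) * \<phi> (\<omega>' j))"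
      by (intro sum.cong refl sum.swap)
    also have "\<dots> = (\<Sum>s\<in>G. \<Sum>\<omega>\<in>\<Omega>. \<Sum>\<omega>'\<in>\<Omega>. \<Prod>j<K. \<phi> (\<omega> j) * swap_proj (s j) (\<omega> j) (\<omega>' j) * \<phi> (\<omega>' j))"
      by (rule sum.swap)
    also have "\<dots> = (\<Sum>s\<in>G. \<Prod>j<K. \<Sum>y\<in>I \<times> I. \<Sum>y'\<in>I \<times> I. \<phi> y * swap_proj (s j) y y' * \<phi> y')"
      unfolding \<Omega>_def using I by (intro sum.cong refl sum_PiE_PiE) auto
    also have "\<dots> = p"
      unfolding p_def \<phi>_def \<mu>_def
      by (intro sum.cong prod.cong refl swap_proj_expectation I u[OF x] v[OF y])
    finally have inner: "inner (L + L) (\<lambda>z. complex_of_real (\<alpha> x (take L z) * \<beta> y (drop L z)))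
        (app (L + L) P (\<lambda>z. complex_of_real (\<alpha> x (take L z) * \<beta> y (drop L z)))) = complex_of_real p" .
    have \<mu>: "0 \<le> \<mu>" "\<mu> \<le> 1"
      using inner_product_sq_le_1[OF I(1) u[OF x] v[OF y]] by (auto simp: \<mu>_def)
    have "correct_whp (f x y) p"
    proof (cases "f x y")
      case True
      then show ?thesis
        using threshold_test(1)[OF \<mu> e K] gap[OF x y] by (simp add: correct_whp_def p_def G_def \<mu>_def)
    next
      case False
      then show ?thesis
        using threshold_test(2)[OF \<mu> e K] gap[OF x y] by (simp add: correct_whp_def p_def G_def \<mu>_def)
    qed
    with inner show "\<exists>p. inner (L + L) (\<lambda>z. complex_of_real (\<alpha> x (take L z) * \<beta> y (drop L z)))
        (app (L + L) P (\<lambda>z. complex_of_real (\<alpha> x (take L z) * \<beta> y (drop L z)))) = complex_of_real p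
        \<and> correct_whp (f x y) p" by blast
  qed
  then show ?thesis by (simp add: L_def)
qed

section \<open>The simulation\<close>

lemma Q_smp_le_of_ent_protocol:
  assumes ent: "ent_computes n f N A \<psi>0 rs q" and n: "1 \<le> n" "n \<le> 2 ^ l"
  shows "Q_smp n f \<le> 2 * (18432 * 16 ^ cost rs * (l + 41 + 12 * cost rs))"
proof -
  define k where "k = cost rs"
  define p where "p x y = prob_one N q (run N x y rs \<psi>0)" for x y
  have correct: "correct_whp (f x y) (p x y)" if "length x = n" "length y = n" for x y
    using ent that by (auto simp: ent_computes_def p_def)
  have p0: "0 \<le> p x y" for x y by (simp add: p_def prob_one_def sum_nonneg)
  obtain J :: "(nat \<times> bool list \<times> bool) set" and a b where J: "finite J"
    and a: "\<And>x. length x = n \<Longrightarrow> (\<Sum>j\<in>J. (a x j)\<^sup>2) \<le> (1 :: real)"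
    and b: "\<And>y. length y = n \<Longrightarrow> (\<Sum>j\<in>J. (b y j)\<^sup>2) \<le> (1 :: real)"
    and ab: "\<And>x y. length x = n \<Longrightarrow> length y = n \<Longrightarrow> (\<Sum>j\<in>J. a x j * b y j) = p x y / 4 ^ k"
    by (rule ent_protocol_factorization[OF ent, folded p_def k_def]) (rule that)
  define \<delta> :: real where "\<delta> = 1 / 4 ^ k"
  have \<delta>: "0 < \<delta>" "\<delta> \<le> 1" by (auto simp: \<delta>_def)
  \<comment> \<open>Dimension reduction with error \<delta> / 12 needs 8 (n + 2) 128^2 12^6 4^(6k)
    coordinates. Since n + 2 <= 3 n, the constants multiply to less than 2^41, and 4^(6k) = 2^(12k).
    Three of the 2^m coordinates are reserved for completing the vectors.\<close>
  define m where "m = l + 41 + 12 * k"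
  define T :: nat where "T = 2 ^ m - 3"
  have pow: "(2 :: real) ^ m = 2 ^ l * 2 ^ 41 * 4 ^ (6 * k)"
    by (simp add: m_def power_add power_mult)
  have "3 \<le> m" by (simp add: m_def)
  then have "(2 :: nat) ^ 3 \<le> 2 ^ m" by (rule power_increasing) simp
  then have T3: "T + 3 = 2 ^ m" by (simp add: T_def)
  then have "real (T + 3) = real (2 ^ m)" by (rule arg_cong)
  then have T: "real T = 2 ^ m - 3" by simp
  have "8 * real (n + 2) * 128\<^sup>2 / (\<delta> / 12) ^ 6 = 8 * real (n + 2) * 128\<^sup>2 * 12 ^ 6 * 4 ^ (6 * k)"
    by (simp add: \<delta>_def power_divide power_mult mult.commute[of 6])
  also have "\<dots> \<le> real T"
  proof -
    have "real n \<le> real (2 ^ l)" using n(2) by (rule of_nat_mono)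
    then have nl: "real n \<le> 2 ^ l" by simp
    have "real n \<ge> 1" using n(1) by simp
    then have "8 * real (n + 2) * 128\<^sup>2 * 12 ^ 6 + 3 \<le> real n * 2 ^ 41" by simp
    also have "\<dots> \<le> 2 ^ l * 2 ^ 41" using nl by simp
    finally have "(8 * real (n + 2) * 128\<^sup>2 * 12 ^ 6 + 3) * 4 ^ (6 * k) \<le> 2 ^ l * 2 ^ 41 * 4 ^ (6 * k)"
      by (rule mult_right_mono) simp
    moreover have "(1 :: real) \<le> 4 ^ (6 * k)" by simp
    ultimately show ?thesis unfolding T pow distrib_right by linarith
  qed
  finally have T_ge: "8 * real (n + 2) * 128\<^sup>2 / (\<delta> / 12) ^ 6 \<le> real T" .
  have eta: "0 < \<delta> / 12" "\<delta> / 12 \<le> 1" using \<delta> by auto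
  obtain w z :: "bool list \<Rightarrow> nat \<Rightarrow> real"
    where w: "\<And>x. x \<in> bits n \<Longrightarrow> (\<Sum>t<T. (w x t)\<^sup>2) \<le> 2"
      and z: "\<And>y. y \<in> bits n \<Longrightarrow> (\<Sum>t<T. (z y t)\<^sup>2) \<le> 2"
      and wz: "\<And>x y. x \<in> bits n \<Longrightarrow> y \<in> bits n \<Longrightarrow>
        \<bar>(\<Sum>t<T. w x t * z y t) - (\<Sum>j\<in>J. a x j * b y j)\<bar> \<le> \<delta> / 12"
    by (rule dimension_reduction[OF J finite_bits[of n] eq_refl[OF card_bits] a b eta T_ge])
      (auto simp: bits_def intro: that)
  \<comment> \<open>Halving leaves squared norm at most 1/2, coordinate T adds the common 1/2, and T
    + 1 or T + 2 completes the norm to 1. These completions sit in different coordinates, so the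
    inner product becomes <w, z> / 4 + 1/2.\<close>
  define u where "u = (\<lambda>x i. if i < T then w x i / 2 else if i = T then sqrt (1 / 2)
    else if i = T + 1 then sqrt (1 / 2 - (\<Sum>t<T. (w x t)\<^sup>2) / 4) else 0)"
  define v where "v = (\<lambda>y i. if i < T then z y i / 2 else if i = T then sqrt (1 / 2)
    else if i = T + 2 then sqrt (1 / 2 - (\<Sum>t<T. (z y t)\<^sup>2) / 4) else 0)"
  have sum_split: "(\<Sum>i<2 ^ m. g i) = (\<Sum>i<T. g i) + g T + g (T + 1) + g (T + 2)" for g :: "nat \<Rightarrow> real"
    unfolding T3[symmetric] by (simp add: numeral_3_eq_3 numeral_2_eq_2)
  have uu: "(\<Sum>i<2 ^ m. (u x i)\<^sup>2) = 1" if "x \<in> bits n" for x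
    unfolding sum_split using w[OF that]
    by (simp add: u_def power_divide sum_divide_distrib[symmetric])
  have vv: "(\<Sum>i<2 ^ m. (v y i)\<^sup>2) = 1" if "y \<in> bits n" for y
    unfolding sum_split using z[OF that]
    by (simp add: v_def power_divide sum_divide_distrib[symmetric])
  have uv: "(\<Sum>i<2 ^ m. u x i * v y i) = (\<Sum>t<T. w x t * z y t) / 4 + 1 / 2" for x y
    unfolding sum_split by (simp add: u_def v_def sum_divide_distrib[symmetric])
  \<comment> \<open>As <w, z> is within \<delta> / 12 of \<delta> p, the excess over 1/2 is at least
    (7/12) \<delta> / 4 for p >= 2/3 and at most (5/12) \<delta> / 4 for p <= 1/3. Since hi + lo >=
    1, the squares differ by at least \<delta> / 24, and \<tau> is their midpoint.\<close>
  define hi where "hi = 1 / 2 + 7 * \<delta> / 48"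
  define lo where "lo = 1 / 2 + 5 * \<delta> / 48"
  define \<tau> where "\<tau> = (hi\<^sup>2 + lo\<^sup>2) / 2"
  have "hi\<^sup>2 - lo\<^sup>2 = \<delta> / 24 * (1 + \<delta> / 4)"
    by (simp add: hi_def lo_def power2_eq_square algebra_simps)
  also have "\<dots> \<ge> \<delta> / 24 * 1" using \<delta> by (intro mult_left_mono) auto
  finally have hilo: "hi\<^sup>2 \<ge> \<tau> + \<delta> / 48" "lo\<^sup>2 \<le> \<tau> - \<delta> / 48"
    by (simp_all add: \<tau>_def field_simps)
  have gap: "if f x y then (\<Sum>i<2 ^ m. u x i * v y i)\<^sup>2 \<ge> \<tau> + \<delta> / 48 else (\<Sum>i<2 ^ m. u x i * v y i)\<^sup>2 \<le> \<tau> - \<delta> / 48"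
    if x: "length x = n" and y: "length y = n" for x y
  proof -
    have close: "\<bar>(\<Sum>t<T. w x t * z y t) - \<delta> * p x y\<bar> \<le> \<delta> / 12"
      using wz[of x y] ab[OF x y] x y by (simp add: bits_def \<delta>_def)
    show ?thesis
    proof (cases "f x y")
      case True
      then have "\<delta> * (2 / 3) \<le> \<delta> * p x y"
        using correct[OF x y] \<delta> by (intro mult_left_mono) (auto simp: correct_whp_def)
      then have "hi \<le> (\<Sum>i<2 ^ m. u x i * v y i)" using close unfolding uv hi_def by linarith
      then have "hi\<^sup>2 \<le> (\<Sum>i<2 ^ m. u x i * v y i)\<^sup>2"
        using \<delta> by (intro power_mono) (auto simp: hi_def)
      then show ?thesis using True hilo by simp
    next
      case False
      then have "\<delta> * p x y \<le> \<delta> * (1 / 3)"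
        using correct[OF x y] \<delta> by (intro mult_left_mono) (auto simp: correct_whp_def)
      then have "(\<Sum>i<2 ^ m. u x i * v y i) \<le> lo" using close unfolding uv lo_def by linarith
      \<comment> \<open>Squaring preserves an upper bound only for nonnegative numbers; p >= 0 and
        the offset 1/2 ensure this.\<close>
      moreover have "0 \<le> \<delta> * p x y" using \<delta> p0 by simp
      then have "0 \<le> (\<Sum>i<2 ^ m. u x i * v y i)" using close \<delta> unfolding uv by linarith
      ultimately have "(\<Sum>i<2 ^ m. u x i * v y i)\<^sup>2 \<le> lo\<^sup>2" by (intro power_mono)
      then show ?thesis using False hilo by simp
    qed
  qed
  have four: "(16 :: real) ^ k = 4 ^ k * 4 ^ k" by (simp add: power_mult_distrib[symmetric])
  \<comment> \<open>18432 = 8 * 48^2, and 16^k = 1 / \<delta>^2.\<close>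
  have K: "real (18432 * 16 ^ k) * (\<delta> / 48)\<^sup>2 \<ge> 8"
    by (simp add: \<delta>_def four power2_eq_square)
  have "Q_smp n f \<le> 2 * (18432 * 16 ^ k * m)"
    by (rule Q_smp_le_of_swap_test[where I = "{..<2 ^ m}" and u = u and v = v and e = "\<delta> / 48" and \<tau> = \<tau>])
      (use uu vv gap \<delta> K in \<open>auto simp: bits_def\<close>)
  then show ?thesis by (simp add: k_def m_def)
qed

theorem theorem4:
  shows "\<exists>C::real. C > 0 \<and>
    (\<forall>n::nat. n \<ge> 2 \<longrightarrow> (\<forall>f :: bool list \<Rightarrow> bool list \<Rightarrow> bool.
       real (Q_smp n f) \<le> C * 2 ^ (8 * Q_ent n f) * log 2 (real n)))"
proof (intro exI[of _ "2027520 :: real"] conjI allI impI)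
  fix n :: nat and f :: "bool list \<Rightarrow> bool list \<Rightarrow> bool"
  assume n: "n \<ge> 2"
  define k where "k = Q_ent n f"
  \<comment> \<open>Since a protocol exists, the minimum is attained, and an optimal protocol can be
    simulated.\<close>
  have "\<exists>k N A \<psi>0 rs q. ent_computes n f N A \<psi>0 rs q \<and> cost rs = k"
    using ent_protocol_exists by blast
  then have "\<exists>N A \<psi>0 rs q. ent_computes n f N A \<psi>0 rs q \<and> cost rs = k"
    unfolding k_def Q_ent_def by (rule LeastI_ex)
  then obtain N A \<psi>0 rs q where ent: "ent_computes n f N A \<psi>0 rs q" "cost rs = k" by blast
  define l where "l = nat \<lceil>log 2 (real n)\<rceil>"
  have log1: "1 \<le> log 2 (real n)" using n by simp
  have l: "log 2 (real n) \<le> real l" "real l \<le> log 2 (real n) + 1"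
    using log1 unfolding l_def by linarith+
  have "real n = 2 powr log 2 (real n)" using n by simp
  also have "\<dots> \<le> 2 powr real l" using l by (intro powr_mono) auto
  also have "\<dots> = real (2 ^ l)" by (simp add: powr_realpow)
  finally have "n \<le> 2 ^ l" by linarith
  with Q_smp_le_of_ent_protocol[OF ent(1)] n ent(2)
  have "Q_smp n f \<le> 2 * (18432 * 16 ^ k * (l + 41 + 12 * k))" by simp
  then have "real (Q_smp n f) \<le> real (2 * (18432 * 16 ^ k * (l + 41 + 12 * k)))" by (rule of_nat_mono)
  also have "\<dots> = 36864 * 16 ^ k * (real l + 41 + 12 * real k)" by simp
  \<comment> \<open>As log n >= 1, l + 41 <= log n + 42 is at most 43 log n, and 12 k <= 12 * 16^k
    log n; so 55 = 43 + 12, and the final constant is 36864 * 55.\<close>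
  also have "\<dots> \<le> 36864 * 16 ^ k * (55 * 16 ^ k * log 2 (real n))"
  proof (intro mult_left_mono)
    have k16: "1 \<le> (16 :: real) ^ k" "real k \<le> 16 ^ k"
    proof -
      have "real k \<le> real (2 ^ k)" using less_exp[of k] by (intro of_nat_mono less_imp_le) 
      also have "\<dots> \<le> 16 ^ k" by (simp add: power_mono)
      finally show "real k \<le> 16 ^ k" .
    qed simp
    have "real l + 41 + 12 * real k \<le> 43 * log 2 (real n) + 12 * (real k * 1)" using l log1 by linarith
    also have "\<dots> \<le> 43 * (16 ^ k * log 2 (real n)) + 12 * (16 ^ k * log 2 (real n))"
      using k16 log1 by (intro add_mono mult_left_mono mult_mono) (auto simp: mult_le_cancel_right1)
    finally show "real l + 41 + 12 * real k \<le> 55 * 16 ^ k * log 2 (real n)"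
      by (simp add: mult_ac)
  qed simp
  also have "\<dots> = 2027520 * (16 ^ k * 16 ^ k) * log 2 (real n)" by simp
  also have "(16 :: real) ^ k * 16 ^ k = 2 ^ (8 * k)"
    by (simp add: power_mult power_mult_distrib[symmetric])
  finally show "real (Q_smp n f) \<le> 2027520 * 2 ^ (8 * Q_ent n f) * log 2 (real n)"
    by (simp add: k_def)
qed simp

end
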